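(* Let $d \ge 2$ and $k \ge 0$ be integers. Then the simplex $S_{d,k} := \operatorname{conv}\bigl(o, s_1 e_1, \ldots, s_{d-1} e_{d-1}, (k+1)(s_d-1) e_d\bigr)$ belongs to $\mathcal{S}^d(k,1)$ and has maximum volume among all simplices in $\mathcal{S}^d(k,1)$; moreover, every simplex $S \in \mathcal{S}^d(k,1)$ with $\operatorname{vol}(S) = \operatorname{vol}(S_{d,k})$ is the image of $S_{d,k}$ under a unimodular transformation.
   Context: $o$ is the origin and $e_1,\ldots,e_d$ the standard basis of $\mathbb{R}^d$. The Sylvester sequence is defined by $s_1 = 2$ and $s_i = 1 + s_1 s_2 \cdots s_{i-1}$ for $i \ge 2$ (so $s_1=2, s_2=3, s_3=7, s_4=43,\ldots$). A lattice polytope is a polytope in $\mathbb{R}^d$ all of whose vertices lie in $\mathbb{Z}^d$. For integers $k, l \ge 0$, $\mathcal{S}^d(k)$ denotes the family of all $d$-dimensional lattice simplices in $\mathbb{R}^d$ whose interior contains exactly $k$ points of $\mathbb{Z}^d$, and $\mathcal{S}^d(k,l)$ denotes the subfamily of those simplices in $\mathcal{S}^d(k)$ that have a facet whose relative interior contains exactly $l$ points of $\mathbb{Z}^d$. $\operatorname{vol}$ is $d$-dimensional Lebesgue measure normalized so that $[0,1]^d$ has volume $1$. A unimodular transformation is an affine map $\phi:\mathbb{R}^d\to\mathbb{R}^d$ with $\phi(\mathbb{Z}^d)=\mathbb{Z}^d$. *)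

theory Defs
  imports "HOL-Analysis.Analysis"
begin

text \<open>The argument 0 lies outside the sequence; the recursion assigns it the value 2 as well, but
  it is never used, since the product starts at index 1.\<close>

function sylvester :: "nat \<Rightarrow> nat" where
  "sylvester i = 1 + (\<Prod>j\<in>{1..<i}. sylvester j)"
  by auto
termination
  by (relation "Wellfounded.measure id") auto

declare sylvester.simps [simp del]

text \<open>The integer lattice of Euclidean space. The dimension is the size of the index type.\<close>

definition int_lattice :: "(real ^ 'n) set" where
  "int_lattice = {x. \<forall>i. x $ i \<in> \<int>}"

definition lattice_polytope :: "(real ^ 'n) set \<Rightarrow> bool" where
  "lattice_polytope P \<longleftrightarrow> polytope P \<and> {v. v extreme_point_of P} \<subseteq> int_lattice"

text \<open>All sets whose lattice points are counted below are bounded, so the counted sets are finite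
  and \<^const>\<open>card\<close> is the true number of points.\<close>

definition simplices_int :: "nat \<Rightarrow> (real ^ 'n) set set" where
  "simplices_int k =
     {S. int CARD('n) simplex S \<and> lattice_polytope S \<and> card (interior S \<inter> int_lattice) = k}"

definition simplices_int_facet :: "nat \<Rightarrow> nat \<Rightarrow> (real ^ 'n) set set" where
  "simplices_int_facet k l =
     {S \<in> simplices_int k. \<exists>F. F facet_of S \<and> card (rel_interior F \<inter> int_lattice) = l}"

text \<open>A finite index type carries no canonical order, so the numbering of the standard basis is a
  parameter: \<^term>\<open>b\<close> enumerates the index type by the numbers from 1 to the dimension, and the
  \<open>i\<close>-th basis vector is \<^term>\<open>axis (b i) 1\<close>.\<close>

definition sylvester_simplex :: "(nat \<Rightarrow> 'n) \<Rightarrow> nat \<Rightarrow> (real ^ 'n) set" where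
  "sylvester_simplex b k =
     (let d = CARD('n) in
      convex hull
        ({0} \<union> {real (sylvester i) *\<^sub>R axis (b i) 1 | i. 1 \<le> i \<and> i \<le> d - 1}
             \<union> {((real k + 1) * (real (sylvester d) - 1)) *\<^sub>R axis (b d) 1}))"

definition unimodular_transformation :: "(real ^ 'n \<Rightarrow> real ^ 'n) \<Rightarrow> bool" where
  "unimodular_transformation \<phi> \<longleftrightarrow>
     (\<exists>f c. linear f \<and> \<phi> = (\<lambda>x. f x + c)) \<and> \<phi> ` int_lattice = int_lattice"

end

theory Submission
  imports Defs
begin

text \<open>
  Let \<open>S\<close> be the hull of an apex \<open>a\<close> and the vertices \<open>v i\<close> of a facet whose only relative
  interior lattice point has barycentric coordinates \<open>\<beta> i\<close>, and let \<open>D = d! vol S\<close>, \<open>N = s_d - 1\<close>.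
  In the coordinates of \<open>x - a\<close> with respect to the edges \<open>v i - a\<close>, consider the box of all points
  that differ from \<open>\<beta>\<close> by less than \<open>\<beta> i\<close> in every coordinate. Of two opposite lattice points of
  this box, one lies in the interior of \<open>S\<close>, so Blichfeldt's theorem gives \<open>D \<Prod> \<beta> i \<le> k + 1\<close>.
  The same argument inside the facet gives \<open>\<Prod>_J \<beta> \<le> 1 - \<Sum>_J \<beta>\<close> for proper subsets \<open>J\<close>, and a
  majorization argument then yields \<open>\<Prod> \<beta> i \<ge> 1 / N^2\<close>, with equality only for the coordinates
  \<open>1 / s_1, \<dots>, 1 / s_(d-1), 1 / N\<close>. Hence \<open>D \<le> (k + 1) N^2\<close>.

  In the case of equality, let \<open>r\<close> be the facet vertex with coordinate \<open>1 / N\<close>. The vectors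
  \<open>(v i - v r) / s_i\<close> form a basis of the lattice of the facet, so \<open>a\<close> has height
  \<open>h = (k + 1) N\<close> over the facet. Each of the lattice layers \<open>1, \<dots>, k\<close> contains an
  interior point, so the layers \<open>k + 1\<close> and \<open>k + 2\<close> contain none. This forces \<open>a - v r\<close> to be
  divisible by \<open>h\<close> in the lattice, except that for \<open>d = 2\<close> the two facet vertices may have to be swapped.
\<close>

section \<open>Sylvester numbers and majorization\<close>

lemma sylvester_Suc: "sylvester (Suc m) = 1 + (\<Prod>j\<in>{1..m}. sylvester j)"
  by (subst sylvester.simps) (simp add: atLeastLessThanSuc_atLeastAtMost)

lemma sylvester_ge_2: "sylvester i \<ge> 2"
proof (induction i rule: less_induct)
  case (less i)
  have "(\<Prod>j\<in>{1..<i}. sylvester j) \<ge> 1"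
    using less by (intro prod_ge_1) (fastforce dest: less)
  then show ?case by (subst sylvester.simps) simp
qed

text \<open>Telescoping: if P is the product of the first m terms, then s_(m+1) = 1 + P, and 1 / P -
  1 / (1 + P) = 1 / (P (1 + P)).\<close>

lemma sum_inverse_sylvester:
  "(\<Sum>i=1..m. 1 / real (sylvester i)) = 1 - 1 / (\<Prod>i=1..m. real (sylvester i))"
proof (induction m)
  case (Suc m)
  define P where "P = (\<Prod>i=1..m. real (sylvester i))"
  have s: "real (sylvester (Suc m)) = 1 + P"
    by (simp add: sylvester_Suc P_def)
  have "P > 0"
    unfolding P_def by (intro prod_pos) (use sylvester_ge_2 in \<open>metis of_nat_0_less_iff less_le_trans pos2\<close>)
  then show ?case
    using Suc by (simp add: s P_def [symmetric] del: One_nat_def) (simp add: field_simps)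
qed auto

text \<open>Summing \<open>ln q \<le> q - 1\<close> over the ratios q = \<open>y i / x i\<close>
  bounds the logarithm of the quotient of the products by the sum of
  \<open>(y i - x i) / x i\<close>. That sum is at most 0: the divisors decrease, and the partial
  sums of \<open>y i - x i\<close> are nonnegative except for the total, which is at most 0. As
  \<open>ln q = q - 1\<close> only at q = 1, equal products force all ratios to be 1.\<close>

lemma prod_le_of_majorized:
  fixes x y :: "nat \<Rightarrow> real"
  assumes pos: "\<And>i. i \<in> {1..n} \<Longrightarrow> x i > 0" "\<And>i. i \<in> {1..n} \<Longrightarrow> y i > 0"
    and dec: "\<And>i j. 1 \<le> i \<Longrightarrow> i \<le> j \<Longrightarrow> j \<le> n \<Longrightarrow> x j \<le> x i"
    and part: "\<And>m. m < n \<Longrightarrow> (\<Sum>i=1..m. x i) \<le> (\<Sum>i=1..m. y i)"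
    and total: "(\<Sum>i=1..n. y i) \<le> (\<Sum>i=1..n. x i)"
  shows "(\<Prod>i=1..n. y i) \<le> (\<Prod>i=1..n. x i)"
    and "(\<Prod>i=1..n. y i) = (\<Prod>i=1..n. x i) \<Longrightarrow> i \<in> {1..n} \<Longrightarrow> x i = y i"
proof -
  \<comment> \<open>Abel summation as an induction: the partial sum up to m is nonnegative, so
    replacing the divisor \<open>x m\<close> by the smaller \<open>x (Suc m)\<close> can only
    enlarge the quotient.\<close>
  have abel: "(\<Sum>i=1..m. (y i - x i) / x i) \<le> (\<Sum>i=1..m. y i - x i) / x m" if "1 \<le> m" "m \<le> n" for m
    using that
  proof (induction m rule: nat_induct_at_least)
    case (Suc m)
    have "0 \<le> (\<Sum>i=1..m. y i - x i)"
      using part [of m] Suc by (simp add: sum_subtractf)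
    moreover have "x (Suc m) \<le> x m" "x (Suc m) > 0"
      using dec [of m "Suc m"] pos Suc by auto
    ultimately have "(\<Sum>i=1..m. y i - x i) / x m \<le> (\<Sum>i=1..m. y i - x i) / x (Suc m)"
      by (intro divide_left_mono) (auto intro!: mult_pos_pos)
    then show ?case
      using Suc by (simp add: add_divide_distrib)
  qed auto
  have le0: "(\<Sum>i=1..n. y i / x i - 1) \<le> 0"
  proof (cases "n = 0")
    case False
    have "(\<Sum>i=1..n. y i / x i - 1) = (\<Sum>i=1..n. (y i - x i) / x i)"
      by (intro sum.cong refl) (use pos in \<open>auto simp: diff_divide_distrib less_le\<close>)
    also have "\<dots> \<le> (\<Sum>i=1..n. y i - x i) / x n"
      using abel False by simp
    also have "\<dots> \<le> 0"
      using total pos(1) [of n] False by (intro divide_nonpos_pos) (auto simp: sum_subtractf)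
    finally show ?thesis .
  qed auto
  have lnle: "ln (y i / x i) \<le> y i / x i - 1" if "i \<in> {1..n}" for i
    using pos that by (intro ln_le_minus_one) auto
  have lnprod: "ln ((\<Prod>i=1..n. y i) / (\<Prod>i=1..n. x i)) = (\<Sum>i=1..n. ln (y i / x i))"
    using pos by (subst prod_dividef [symmetric], subst ln_prod) (auto simp: less_le)
  have Px: "(\<Prod>i=1..n. x i) > 0" and Py: "(\<Prod>i=1..n. y i) > 0"
    using pos by (auto intro: prod_pos)
  have sle: "(\<Sum>i=1..n. ln (y i / x i)) \<le> (\<Sum>i=1..n. y i / x i - 1)"
    by (intro sum_mono lnle)
  then have "ln ((\<Prod>i=1..n. y i) / (\<Prod>i=1..n. x i)) \<le> 0"
    using le0 lnprod by linarith
  then show "(\<Prod>i=1..n. y i) \<le> (\<Prod>i=1..n. x i)"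
    using Px Py by simp
  assume eq: "(\<Prod>i=1..n. y i) = (\<Prod>i=1..n. x i)" and i: "i \<in> {1..n}"
  have "(\<Sum>i=1..n. ln (y i / x i)) = 0"
    using lnprod unfolding eq using Px by (metis divide_self less_irrefl ln_one)
  then have "(\<Sum>i=1..n. (y i / x i - 1) - ln (y i / x i)) \<le> 0"
    using le0 by (simp add: sum_subtractf)
  moreover have "\<And>i. i \<in> {1..n} \<Longrightarrow> (y i / x i - 1) - ln (y i / x i) \<ge> 0"
    using lnle by auto
  ultimately have "(y i / x i - 1) - ln (y i / x i) = 0"
    using i by (metis (mono_tags, lifting) finite_atLeastAtMost antisym sum_nonneg sum_nonneg_eq_0_iff)
  then have "y i / x i = 1"
    using ln_eq_minus_one [of "y i / x i"] pos i by auto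
  then show "x i = y i"
    using pos(1)[OF i] by simp
qed

text \<open>Soundararajan's induction: the first partial sum exceeding the Sylvester sum would, by
  majorization, also have too large a product.\<close>

lemma sylvester_partial_sums:
  fixes x :: "nat \<Rightarrow> real"
  assumes pos: "\<And>i. i \<in> {1..n} \<Longrightarrow> x i > 0"
    and dec: "\<And>i j. 1 \<le> i \<Longrightarrow> i \<le> j \<Longrightarrow> j \<le> n \<Longrightarrow> x j \<le> x i"
    and prod: "\<And>m. m \<le> n \<Longrightarrow> (\<Prod>i=1..m. x i) \<le> 1 - (\<Sum>i=1..m. x i)"
  shows "m \<le> n \<Longrightarrow> (\<Sum>i=1..m. x i) \<le> (\<Sum>i=1..m. 1 / real (sylvester i))"
proof (induction m rule: less_induct)
  case (less m)
  show ?case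
  proof (rule ccontr)
    assume neg: "\<not> ?case"
    have spos: "0 < sylvester i" for i
      using sylvester_ge_2 [of i] by linarith
    have "(\<Prod>i=1..m. 1 / real (sylvester i)) \<le> (\<Prod>i=1..m. x i)"
      using neg less by (intro prod_le_of_majorized) (auto intro: pos dec simp: spos)
    also have "\<dots> \<le> 1 - (\<Sum>i=1..m. x i)"
      using prod less by simp
    \<comment> \<open>The product of the Sylvester reciprocals is 1 minus their sum, so the chain
      bounds the sum of the \<open>x i\<close> by the Sylvester sum, against
      \<open>neg\<close>.\<close>
    finally show False
      using neg sum_inverse_sylvester [of m] by (simp add: prod_dividef)
  qed
qed

lemma prod_ge_sylvester:
  fixes x :: "nat \<Rightarrow> real"
  assumes n: "n \<ge> 1"
    and pos: "\<And>i. i \<in> {1..n} \<Longrightarrow> x i > 0"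
    and dec: "\<And>i j. 1 \<le> i \<Longrightarrow> i \<le> j \<Longrightarrow> j \<le> n \<Longrightarrow> x j \<le> x i"
    and prod: "\<And>m. m < n \<Longrightarrow> (\<Prod>i=1..m. x i) \<le> 1 - (\<Sum>i=1..m. x i)"
    and total: "(\<Sum>i=1..n. x i) = 1"
  defines "N \<equiv> real (sylvester n) - 1"
  shows "1 / N\<^sup>2 \<le> (\<Prod>i=1..n. x i)"
    and "1 / N\<^sup>2 = (\<Prod>i=1..n. x i) \<Longrightarrow> i \<in> {1..<n} \<Longrightarrow> x i = 1 / sylvester i"
    and "1 / N\<^sup>2 = (\<Prod>i=1..n. x i) \<Longrightarrow> x n = 1 / N"
proof -
  obtain m where m: "n = Suc m"
    using n by (cases n) auto
  \<comment> \<open>Replacing the last reciprocal 1 / s_n by 1 / N makes the total exactly 1. The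
    earlier reciprocals multiply to 1 / N as well, whence the square in the bound.\<close>
  define y where "y i = (if i = n then 1 / N else 1 / real (sylvester i))" for i
  have N: "N = (\<Prod>i=1..m. real (sylvester i))"
    by (simp add: N_def m sylvester_Suc)
  have spos: "0 < sylvester i" for i
    using sylvester_ge_2 [of i] by linarith
  have Npos: "N > 0"
    unfolding N by (intro prod_pos) (simp add: spos)
  have ypos: "y i > 0" for i
    using Npos by (simp add: y_def spos)
  have ycong: "(\<Sum>i=1..j. y i) = (\<Sum>i=1..j. 1 / real (sylvester i))" if "j < n" for j
    using that by (intro sum.cong) (auto simp: y_def)
  have Py: "(\<Prod>i=1..n. y i) = 1 / N\<^sup>2"
  proof -
    have "(\<Prod>i=1..m. y i) = (\<Prod>i=1..m. 1 / real (sylvester i))"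
      by (intro prod.cong) (auto simp: y_def m)
    then show ?thesis
      by (simp add: m prod_dividef N power2_eq_square) (simp add: y_def m N)
  qed
  \<comment> \<open>The partial sum bound is applied with length m = n - 1, since at n the product
    inequality would bound a positive product by 0.\<close>
  have part: "(\<Sum>i=1..j. x i) \<le> (\<Sum>i=1..j. y i)" if "j < n" for j
    unfolding ycong [OF that]
    using that prod by (intro sylvester_partial_sums [where n = m]) (auto simp: m intro: pos dec)
  have ty: "(\<Sum>i=1..n. y i) = 1"
    using ycong [of m] sum_inverse_sylvester [of m] Npos by (simp add: m N) (simp add: y_def m N)
  have tot: "(\<Sum>i=1..n. y i) \<le> (\<Sum>i=1..n. x i)"
    using ty total by linarith
  note * = prod_le_of_majorized [OF pos ypos dec part tot, unfolded Py]
  show "1 / N\<^sup>2 \<le> (\<Prod>i=1..n. x i)"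
    by (rule *) auto
  show "1 / N\<^sup>2 = (\<Prod>i=1..n. x i) \<Longrightarrow> i \<in> {1..<n} \<Longrightarrow> x i = 1 / sylvester i"
    using *(2) [of i] by (auto simp: y_def)
  show "1 / N\<^sup>2 = (\<Prod>i=1..n. x i) \<Longrightarrow> x n = 1 / N"
    using *(2) [of n] n by (auto simp: y_def)
qed

section \<open>Lebesgue measure under linear maps\<close>

text \<open>The library version of this fact assumes a well-ordered index type.\<close>

lemma measure_linear_image_cart:
  fixes f :: "real ^ 'n::finite \<Rightarrow> real ^ 'n"
  assumes "linear f" "S \<in> lmeasurable"
  shows "f ` S \<in> lmeasurable \<and> measure lebesgue (f ` S) = \<bar>det (matrix f)\<bar> * measure lebesgue S"
proof -
  define P :: "(real ^ 'n \<Rightarrow> real ^ 'n) \<Rightarrow> bool" where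
    "P f \<longleftrightarrow> (\<forall>S \<in> lmeasurable. f ` S \<in> lmeasurable \<and>
       measure lebesgue (f ` S) = \<bar>det (matrix f)\<bar> * measure lebesgue S)" for f
  \<comment> \<open>For determinant 1 or -1, preserving the volume of boxes suffices for all
    measurable sets; this serves the coordinate swaps and the shears below.\<close>
  have boxes: "P f" if "linear f" and d: "\<bar>det (matrix f)\<bar> = 1"
    and m: "\<And>a b. cbox a b \<noteq> {} \<Longrightarrow> measure lebesgue (f ` cbox a b) = measure lebesgue (cbox a b)" for f
  proof -
    have *: "measure lebesgue (f ` cbox a b) = 1 * measure lebesgue (cbox a b)" for a b
      using m [of a b] by (cases "cbox a b = {}") auto
    show ?thesis
      unfolding P_def d
    proof (intro ballI)
      fix S :: "(real ^ 'n) set"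
      assume "S \<in> lmeasurable"
      from measure_linear_sufficient [OF \<open>linear f\<close> this *]
      show "f ` S \<in> lmeasurable \<and> measure lebesgue (f ` S) = 1 * measure lebesgue S"
        by simp
    qed
  qed
  \<comment> \<open>Every linear map is composed of maps annihilating a coordinate, diagonal
    scalings, coordinate swaps and shears.\<close>
  have "P f"
  proof (rule induct_linear_elementary [OF \<open>linear f\<close>])
    fix f g :: "real ^ 'n \<Rightarrow> real ^ 'n"
    assume "linear f" "linear g" "P f" "P g"
    then show "P (f \<circ> g)"
      by (simp add: P_def image_image [symmetric] matrix_compose [unfolded o_def] o_def det_mul abs_mult)
  next
    fix f :: "real ^ 'n \<Rightarrow> real ^ 'n" and i
    assume f: "linear f" and 0: "\<And>x. f x $ i = 0"
    have "\<not> surj f"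
      using 0 by (metis axis_eq_0_iff axis_nth surjD zero_neq_one)
    then have "\<not> inj f"
      using f linear_injective_imp_surjective by blast
    then show "P f"
      unfolding P_def using f det_nz_iff_inj [OF f] negligible_linear_singular_image [OF f]
      by (simp add: negligible_imp_measure0 negligible_iff_measure)
  next
    fix c :: "'n \<Rightarrow> real"
    show "P (\<lambda>x. \<chi> i. c i * x $ i)"
      unfolding P_def
      by (auto simp: measurable_stretch measure_stretch matrix_def axis_def det_diagonal)
  next
    fix m n :: 'n
    assume "m \<noteq> n"
    let ?t = "Transposition.transpose m n"
    let ?h = "\<lambda>x::real ^ 'n. \<chi> i. x $ ?t i"
    have lin: "linear ?h"
      by (rule linearI) (simp_all add: vec_eq_iff)
    show "P ?h"
    proof (rule boxes [OF lin])
      have "matrix ?h = (\<chi> i. mat 1 $ ?t i)"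
        by (auto simp: matrix_def mat_def axis_def vec_eq_iff)
      then show "\<bar>det (matrix ?h)\<bar> = 1"
        by (simp add: det_permute_rows permutes_swap_id sign_swap_id)
      show "measure lebesgue (?h ` cbox a b) = measure lebesgue (cbox a b)" if ne: "cbox a b \<noteq> {}" for a b
      proof -
        have "?h ` cbox a b = cbox (?h a) (?h b)"
        proof (intro set_eqI iffI)
          fix x assume "x \<in> cbox (?h a) (?h b)"
          then have "?h x \<in> cbox a b"
            by (simp add: mem_box_cart) (metis transpose_involutory)
          moreover have "x = ?h (?h x)"
            by (simp add: vec_eq_iff)
          ultimately show "x \<in> ?h ` cbox a b"
            by blast
        qed (auto simp: mem_box_cart)
        moreover from this have "cbox (?h a) (?h b) \<noteq> {}"
          using ne by auto
        ultimately show ?thesis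
          using ne prod.reindex_bij_betw [of ?t UNIV UNIV "\<lambda>i. b $ i - a $ i"]
          by (simp add: content_cbox_cart)
      qed
    qed
  next
    fix m n :: 'n
    assume mn: "m \<noteq> n"
    let ?h = "\<lambda>x::real ^ 'n. \<chi> i. if i = m then x $ m + x $ n else x $ i"
    have lin: "linear ?h"
      by (rule linearI) (simp_all add: vec_eq_iff algebra_simps)
    show "P ?h"
    proof (rule boxes [OF lin])
      have "matrix ?h = (\<chi> i. if i = m then row m (mat 1) + 1 *s row n (mat 1) else row i (mat 1))"
        using mn by (auto simp: matrix_def mat_def axis_def row_def vec_eq_iff)
      then show "\<bar>det (matrix ?h)\<bar> = 1"
        using det_row_operation [OF mn, of "mat 1 :: real ^ 'n ^ 'n" 1] by simp
      fix a b :: "real ^ 'n"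
      assume ne: "cbox a b \<noteq> {}"
      \<comment> \<open>The box is moved to have its lower corner at the origin, because
        \<open>measure_shear_interval\<close> asks for a lower corner with nonnegative n-th
        coordinate.\<close>
      have cb: "cbox a b = (+) a ` cbox 0 (b - a)"
        by (simp add: cbox_translation [symmetric])
      have "?h ` cbox a b = (+) (?h a) ` ?h ` cbox 0 (b - a)"
        unfolding cb image_image by (intro image_cong refl) (simp add: vec_eq_iff)
      then have "measure lebesgue (?h ` cbox a b) = measure lebesgue (?h ` cbox 0 (b - a))"
        by (simp only: measure_translation)
      also have "\<dots> = measure lebesgue (cbox 0 (b - a))"
        using mn ne cb by (intro measure_shear_interval) auto
      also have "\<dots> = measure lebesgue (cbox a b)"
        unfolding cb by (simp only: measure_translation)
      finally show "measure lebesgue (?h ` cbox a b) = measure lebesgue (cbox a b)" .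
    qed
  qed
  then show ?thesis
    using assms(2) by (simp add: P_def)
qed

section \<open>Blichfeldt's theorem\<close>

lemma int_lattice_simps [simp, intro]:
  "0 \<in> int_lattice"
  "x \<in> int_lattice \<Longrightarrow> y \<in> int_lattice \<Longrightarrow> x + y \<in> int_lattice"
  "x \<in> int_lattice \<Longrightarrow> y \<in> int_lattice \<Longrightarrow> x - y \<in> int_lattice"
  "x \<in> int_lattice \<Longrightarrow> - x \<in> int_lattice"
  "c \<in> \<int> \<Longrightarrow> x \<in> int_lattice \<Longrightarrow> c *\<^sub>R x \<in> int_lattice"
  "axis i 1 \<in> int_lattice"
  by (auto simp: int_lattice_def axis_def)

lemma int_matrix_mult_int_lattice:
  fixes A :: "real ^ 'n ^ 'm"
  assumes "\<And>i j. A $ i $ j \<in> \<int>" "x \<in> int_lattice"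
  shows "A *v x \<in> int_lattice"
  using assms by (auto simp: int_lattice_def matrix_vector_mult_def)

lemma det_Ints:
  fixes A :: "real ^ 'n ^ 'n"
  assumes "\<And>i j. A $ i $ j \<in> \<int>"
  shows "det A \<in> \<int>"
  unfolding det_def using assms by (auto intro!: Ints_sum Ints_mult Ints_prod)

text \<open>The matrix determinant lemma for I - x y^T. Let E be the identity with row k replaced by
  y, and C the identity with column k replaced by \<open>axis k 1 - E *v x\<close>. As row k of E is
  y, E (I - x y^T) = C E. Cramer's rule gives the determinants of E and C, and
  \<open>y $ k \<noteq> 0\<close> allows cancelling det E.\<close>

lemma det_diff_rank_one:
  fixes x y :: "'a::field ^ 'n"
  shows "det (\<chi> i j. mat 1 $ i $ j - x $ i * y $ j) = 1 - (\<Sum>i\<in>UNIV. x $ i * y $ i)"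
proof (cases "y = 0")
  case True
  then have "(\<chi> i j. mat 1 $ i $ j - x $ i * y $ j) = mat 1"
    by (simp add: vec_eq_iff)
  then show ?thesis
    using True by simp
next
  case False
  then obtain k where k: "y $ k \<noteq> 0"
    by (auto simp: vec_eq_iff)
  define M where "M = (\<chi> i j. mat 1 $ i $ j - x $ i * y $ j)"
  define E :: "'a ^ 'n ^ 'n" where "E = (\<chi> i. if i = k then y else axis i 1)"
  define C where "C = (\<chi> i j. if j = k then axis k 1 $ i - (E *v x) $ i else mat 1 $ i $ j)"
  have "E = (\<chi> i. if i = k then (\<Sum>i\<in>UNIV. y $ i *s row i (mat 1)) else row i (mat 1))"
    by (auto simp: E_def vec_eq_iff row_def mat_def axis_def if_distrib cong: if_cong)
  then have E: "det E = y $ k"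
    using cramer_lemma_transpose [of k y "mat 1"] by simp
  have "C = (\<chi> i j. if j = k then (mat 1 *v (axis k 1 - E *v x)) $ i else mat 1 $ i $ j)"
    unfolding C_def matrix_vector_mul_lid vector_minus_component ..
  then have "det C = (axis k 1 - E *v x) $ k * det (mat 1 :: 'a ^ 'n ^ 'n)"
    using cramer_lemma [of k "mat 1" "axis k 1 - E *v x"] by simp
  then have C: "det C = 1 - (\<Sum>i\<in>UNIV. x $ i * y $ i)"
    by (simp add: E_def matrix_vector_mult_def axis_def mult.commute)
  have "(E ** M) $ i $ j = (C ** E) $ i $ j" for i j
  proof -
    have "(E ** M) $ i $ j = (E ** mat 1) $ i $ j - (E *v x) $ i * y $ j"
      by (simp add: M_def matrix_matrix_mult_def matrix_vector_mult_def right_diff_distrib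
          sum_subtractf sum_distrib_right mult.assoc del: matrix_mul_rid)
    also have "\<dots> = (mat 1 ** E) $ i $ j - (\<Sum>l\<in>UNIV. if l = k then (E *v x) $ i * E $ l $ j else 0)"
      by (simp add: E_def)
    also have "\<dots> = (\<Sum>l\<in>UNIV. (mat 1 $ i $ l - (if l = k then (E *v x) $ i else 0)) * E $ l $ j)"
      by (simp add: matrix_matrix_mult_def left_diff_distrib sum_subtractf if_distribR
          del: matrix_mul_lid sum.delta cong: if_cong) (intro sum.cong, auto)
    also have "\<dots> = (C ** E) $ i $ j"
      unfolding matrix_matrix_mult_def
      by (simp add: C_def) (intro sum.cong, auto simp: mat_def axis_def)
    finally show ?thesis .
  qed
  then have "E ** M = C ** E"
    by (simp add: vec_eq_iff)
  then have "det E * det M = det C * det E"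
    by (metis det_mul)
  then show ?thesis
    using k by (simp add: E C M_def)
qed

lemma finite_int_lattice_Int_bounded:
  fixes S :: "(real ^ 'n) set"
  assumes "bounded S"
  shows "finite (S \<inter> int_lattice)"
proof -
  obtain B where B: "\<And>x. x \<in> S \<Longrightarrow> norm x \<le> B"
    using assms bounded_iff by blast
  let ?I = "{k \<in> \<int>. - B \<le> k \<and> k \<le> B}"
  have "S \<inter> int_lattice \<subseteq> vec_lambda ` (PiE UNIV (\<lambda>_. ?I))"
  proof
    fix x assume x: "x \<in> S \<inter> int_lattice"
    then have "\<bar>x $ i\<bar> \<le> B" for i
      using B [of x] component_le_norm_cart [of x i] by force
    then have "vec_nth x \<in> PiE UNIV (\<lambda>_. ?I)"
      using x by (auto simp: int_lattice_def abs_le_iff minus_le_iff)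
    then show "x \<in> vec_lambda ` (PiE UNIV (\<lambda>_. ?I))"
      by (rule image_eqI [rotated]) (rule vec_nth_inverse [symmetric])
  qed
  then show ?thesis
    by (rule finite_subset) (intro finite_imageI finite_PiE ballI finite_int_segment, auto)
qed

text \<open>Averaging: the number of lattice vectors z with x + z in K, integrated over x in the
  unit cube, is at least the volume of K. Were this number at most m on the whole cube, the volume
  would be at most m.\<close>

lemma blichfeldt:
  fixes K :: "(real ^ 'n) set"
  assumes K: "bounded K" "K \<in> lmeasurable" and m: "real m < measure lebesgue K"
  obtains x Z where "finite Z" "card Z = Suc m" "Z \<subseteq> int_lattice" "\<And>z. z \<in> Z \<Longrightarrow> x + z \<in> K"
proof -
  define Q :: "(real ^ 'n) set" where "Q = cbox 0 1"
  have Q: "Q \<in> lmeasurable" "measure lebesgue Q = 1"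
    by (auto simp: Q_def content_cbox_if_cart interval_ne_empty_cart)
  define Z where "Z = {z \<in> int_lattice. \<exists>x\<in>Q. x + z \<in> K}"
  have "finite Z"
  proof -
    obtain B C where "\<And>x. x \<in> K \<Longrightarrow> norm x \<le> B" "\<And>x. x \<in> Q \<Longrightarrow> norm x \<le> C"
      using K(1) bounded_cbox [of "0 :: real ^ 'n" 1] unfolding Q_def bounded_iff by blast
    then have "norm z \<le> B + C" if "x \<in> Q" "x + z \<in> K" for x z
      using that norm_triangle_ineq4 [of "x + z" x] by force
    then have "Z \<subseteq> cball 0 (B + C) \<inter> int_lattice"
      by (auto simp: Z_def)
    then show ?thesis
      using finite_int_lattice_Int_bounded [OF bounded_cball] finite_subset by blast
  qed
  have meas: "(\<lambda>x. x - z) ` K \<inter> Q \<in> lmeasurable" for z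
    using K Q by (intro fmeasurable.Int measurable_translation_subtract)
  have int: "integrable lebesgue (indicat_real ((\<lambda>x. x - z) ` K \<inter> Q))" for z
    using meas [of z] by (intro integrable_real_indicator) (auto simp: fmeasurable_def)
  have "\<exists>x\<in>Q. m < card {z \<in> Z. x + z \<in> K}"
  proof (rule ccontr)
    assume "\<not> ?thesis"
    then have le: "card {z \<in> Z. x + z \<in> K} \<le> m" if "x \<in> Q" for x
      using that by (meson not_le_imp_less)
    \<comment> \<open>Rounding down the coordinates moves any point of K into the cube. Overlaps of
      the closed cubes only increase the sum that bounds the volume.\<close>
    have "K \<subseteq> (\<Union>z\<in>Z. (+) z ` ((\<lambda>x. x - z) ` K \<inter> Q))"
    proof
      fix x assume x: "x \<in> K"
      define z :: "real ^ 'n" where "z = (\<chi> i. of_int \<lfloor>x $ i\<rfloor>)"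
      have "x - z \<in> Q"
        by (auto simp: z_def Q_def mem_box_cart) linarith
      moreover have "z \<in> Z"
        using x \<open>x - z \<in> Q\<close> by (auto simp: Z_def z_def int_lattice_def intro!: bexI [of _ "x - z"])
      ultimately show "x \<in> (\<Union>z\<in>Z. (+) z ` ((\<lambda>x. x - z) ` K \<inter> Q))"
        using x by (intro UN_I [of z] image_eqI [of _ _ "x - z"]) auto
    qed
    then have "measure lebesgue K \<le> measure lebesgue (\<Union>z\<in>Z. (+) z ` ((\<lambda>x. x - z) ` K \<inter> Q))"
      using K \<open>finite Z\<close> meas
      by (intro measure_mono_fmeasurable) (auto intro!: fmeasurable.finite_UN measurable_translation)
    also have "\<dots> \<le> (\<Sum>z\<in>Z. measure lebesgue ((+) z ` ((\<lambda>x. x - z) ` K \<inter> Q)))"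
      using \<open>finite Z\<close> meas measurable_translation by (intro measure_UNION_le) blast+
    also have "\<dots> = (\<Sum>z\<in>Z. measure lebesgue ((\<lambda>x. x - z) ` K \<inter> Q))"
      by (simp only: measure_translation)
    also have "\<dots> = (\<Sum>z\<in>Z. \<integral>x. indicator ((\<lambda>x. x - z) ` K \<inter> Q) x \<partial>lebesgue)"
      by simp
    also have "\<dots> = (\<integral>x. (\<Sum>z\<in>Z. indicator ((\<lambda>x. x - z) ` K \<inter> Q) x) \<partial>lebesgue)"
      by (intro Bochner_Integration.integral_sum [symmetric] int)
    also have "\<dots> \<le> (\<integral>x. real m * indicator Q x \<partial>lebesgue)"
    proof (rule integral_mono)
      show "integrable lebesgue (\<lambda>x. \<Sum>z\<in>Z. indicat_real ((\<lambda>x. x - z) ` K \<inter> Q) x)"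
        by (intro Bochner_Integration.integrable_sum int)
      show "integrable lebesgue (\<lambda>x. real m * indicat_real Q x)"
        using Q by (intro integrable_mult_right integrable_real_indicator) (auto simp: fmeasurable_def)
      fix x
      have "(\<Sum>z\<in>Z. indicat_real ((\<lambda>x. x - z) ` K \<inter> Q) x) =
          (\<Sum>z\<in>Z. if x + z \<in> K then indicat_real Q x else 0)"
        by (intro sum.cong refl) (force simp: indicator_def image_iff algebra_simps)
      also have "\<dots> = real (card {z \<in> Z. x + z \<in> K}) * indicat_real Q x"
        using \<open>finite Z\<close> by (simp add: sum.If_cases Int_def)
      also have "\<dots> \<le> real m * indicat_real Q x"
        using le [of x] by (auto simp: indicator_def)
      finally show "(\<Sum>z\<in>Z. indicat_real ((\<lambda>x. x - z) ` K \<inter> Q) x) \<le> real m * indicat_real Q x" .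
    qed
    also have "\<dots> = real m"
      using Q by simp
    finally show False
      using m by simp
  qed
  then obtain x where "Suc m \<le> card {z \<in> Z. x + z \<in> K}"
    by (auto simp: Suc_le_eq)
  then obtain Z' where "Z' \<subseteq> {z \<in> Z. x + z \<in> K}" "finite Z'" "card Z' = Suc m"
    by (meson obtain_subset_with_card_n)
  then show thesis
    by (intro that [of Z' x]) (auto simp: Z_def)
qed

text \<open>Blichfeldt's theorem for the preimage under A of the open box from 0 to c: its volume is
  the product of the \<open>c i\<close> divided by |det A|, and the images of any two of its points
  differ by less than \<open>c i\<close> in coordinate i.\<close>

lemma blichfeldt_linear_forms:
  fixes A :: "real ^ 'n ^ 'n" and c :: "'n \<Rightarrow> real"
  assumes A: "det A \<noteq> 0" and c: "\<And>i. c i > 0"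
    and m: "real m * \<bar>det A\<bar> < (\<Prod>i\<in>UNIV. c i)"
  obtains Z where "finite Z" "card Z = Suc m" "Z \<subseteq> int_lattice"
    "\<And>z z' i. z \<in> Z \<Longrightarrow> z' \<in> Z \<Longrightarrow> \<bar>(A *v (z - z')) $ i\<bar> < c i"
proof -
  obtain B where B: "A ** B = mat 1" "B ** A = mat 1"
    using A invertible_det_nz unfolding invertible_def by blast
  define K where "K = (*v) B ` box 0 (\<chi> i. c i)"
  have AK: "0 < (A *v x) $ i \<and> (A *v x) $ i < c i" if "x \<in> K" for x i
    using that by (auto simp: K_def matrix_vector_mul_assoc B mem_box_cart)
  have detB: "\<bar>det B\<bar> = 1 / \<bar>det A\<bar>"
    using B(1) A by (metis abs_1 abs_mult det_I det_mul nonzero_mult_div_cancel_left abs_eq_0)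
  have lin: "linear ((*v) B)"
    by (rule matrix_vector_mul_linear)
  have "measure lebesgue K = \<bar>det B\<bar> * measure lebesgue (box 0 (\<chi> i. c i))"
    unfolding K_def using measure_linear_image_cart [OF lin, of "box 0 (\<chi> i. c i)"] by simp
  also have "measure lebesgue (box 0 (\<chi> i. c i)) = measure lebesgue (cbox 0 (\<chi> i. c i))"
    by (simp add: measure_lborel_box_eq measure_lborel_cbox_eq)
  also have "\<dots> = (\<Prod>i\<in>UNIV. c i)"
    using c by (simp add: content_cbox_cart interval_ne_empty_cart less_imp_le)
  finally have "real m < measure lebesgue K"
    using m A by (simp add: detB pos_less_divide_eq)
  moreover have "bounded K" "K \<in> lmeasurable"
    unfolding K_def using measure_linear_image_cart [OF lin, of "box 0 (\<chi> i. c i)"]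
      bounded_linear_image [OF bounded_box matrix_vector_mul_bounded_linear] by auto
  ultimately obtain x Z where Z: "finite Z" "card Z = Suc m" "Z \<subseteq> int_lattice"
    "\<And>z. z \<in> Z \<Longrightarrow> x + z \<in> K"
    using blichfeldt by metis
  have "\<bar>(A *v (z - z')) $ i\<bar> < c i" if "z \<in> Z" "z' \<in> Z" for z z' i
  proof -
    have "A *v (z - z') = A *v (x + z) - A *v (x + z')"
      by (simp add: matrix_vector_mult_diff_distrib matrix_vector_right_distrib)
    then show ?thesis
      using AK [OF Z(4) [OF that(1)], of i] AK [OF Z(4) [OF that(2)], of i]
      by (simp add: abs_less_iff)
  qed
  then show thesis
    using that Z by blast
qed

section \<open>Facets with a single lattice point\<close>

text \<open>For invertible V this is the inverse image of the integer lattice. In it the simplex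
  with edge vectors the columns of V becomes the standard simplex, at the price of a general
  lattice.\<close>

definition lattice_coords :: "real ^ 'n ^ 'n \<Rightarrow> (real ^ 'n) set" where
  "lattice_coords V = {x. V *v x \<in> int_lattice}"

lemma lattice_coords_simps [simp, intro]:
  "0 \<in> lattice_coords V"
  "x \<in> lattice_coords V \<Longrightarrow> y \<in> lattice_coords V \<Longrightarrow> x + y \<in> lattice_coords V"
  "x \<in> lattice_coords V \<Longrightarrow> y \<in> lattice_coords V \<Longrightarrow> x - y \<in> lattice_coords V"
  "x \<in> lattice_coords V \<Longrightarrow> - x \<in> lattice_coords V"
  "c \<in> \<int> \<Longrightarrow> x \<in> lattice_coords V \<Longrightarrow> c *\<^sub>R x \<in> lattice_coords V"
  by (simp_all add: lattice_coords_def matrix_vector_right_distrib matrix_vector_mult_diff_distrib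
      matrix_vector_mult_scaleR mult_minus_right)
     (metis int_lattice_simps(4) matrix_vector_mult_diff_distrib diff_0 matrix_vector_mult_0_right)

lemma lattice_coords_sum [intro]:
  "(\<And>i. i \<in> A \<Longrightarrow> f i \<in> lattice_coords V) \<Longrightarrow> sum f A \<in> lattice_coords V"
  by (induction A rule: infinite_finite_induct) auto

lemma finite_lattice_coords_Int_bounded:
  fixes V :: "real ^ 'n ^ 'n"
  assumes "det V \<noteq> 0" "bounded S"
  shows "finite (S \<inter> lattice_coords V)"
proof -
  have "bounded ((*v) V ` S)"
    using assms(2) matrix_vector_mul_bounded_linear by (rule bounded_linear_image)
  then have "finite ((*v) V ` S \<inter> int_lattice)"
    by (rule finite_int_lattice_Int_bounded)
  moreover have "(*v) V ` (S \<inter> lattice_coords V) \<subseteq> (*v) V ` S \<inter> int_lattice"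
    by (auto simp: lattice_coords_def)
  moreover have "inj ((*v) V)"
    using assms(1) by (metis invertible_det_nz invertible_def inj_matrix_vector_mult)
  ultimately show ?thesis
    by (meson finite_imageD finite_subset inj_on_subset subset_UNIV)
qed

text \<open>The apex is at 0 and the facet vertices are the unit vectors, so the coordinate sum is 0
  at the apex and 1 on the facet.\<close>

definition interior_coords :: "real ^ 'n ^ 'n \<Rightarrow> (real ^ 'n) set" where
  "interior_coords V = {x \<in> lattice_coords V. (\<forall>i. 0 < x $ i) \<and> (\<Sum>i\<in>UNIV. x $ i) < 1}"

definition facet_coords :: "real ^ 'n ^ 'n \<Rightarrow> (real ^ 'n) set" where
  "facet_coords V = {x \<in> lattice_coords V. (\<forall>i. 0 < x $ i) \<and> (\<Sum>i\<in>UNIV. x $ i) = 1}"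

lemma finite_interior_coords:
  fixes V :: "real ^ 'n ^ 'n"
  assumes "det V \<noteq> 0"
  shows "finite (interior_coords V)"
proof -
  have "x $ i \<le> 1" if "x \<in> interior_coords V" for x i
  proof -
    have "x $ i \<le> (\<Sum>i\<in>UNIV. x $ i)"
      using that by (intro member_le_sum) (auto simp: interior_coords_def less_imp_le)
    then show ?thesis
      using that by (simp add: interior_coords_def)
  qed
  then have "interior_coords V \<subseteq> cbox 0 1 \<inter> lattice_coords V"
    by (auto simp: interior_coords_def mem_box_cart less_imp_le)
  then show ?thesis
    using finite_lattice_coords_Int_bounded [OF assms bounded_cbox] finite_subset by blast
qed

locale unique_facet_point =
  fixes V :: "real ^ 'n ^ 'n" and \<beta> :: "real ^ 'n"
  assumes V_int: "V $ i $ j \<in> \<int>"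
    and det_V: "det V \<noteq> 0"
    and facet_coords_eq: "facet_coords V = {\<beta>}"
begin

lemma beta: "\<beta> \<in> lattice_coords V" "0 < \<beta> $ i" "(\<Sum>i\<in>UNIV. \<beta> $ i) = 1"
  using facet_coords_eq unfolding facet_coords_def by blast+

lemma facet_coords_unique:
  "x \<in> lattice_coords V \<Longrightarrow> (\<And>i. 0 < x $ i) \<Longrightarrow> (\<Sum>i\<in>UNIV. x $ i) = 1 \<Longrightarrow> x = \<beta>"
  using facet_coords_eq unfolding facet_coords_def by blast

lemma int_lattice_coords: "x \<in> int_lattice \<Longrightarrow> x \<in> lattice_coords V"
  unfolding lattice_coords_def using V_int int_matrix_mult_int_lattice by blast

text \<open>Otherwise Blichfeldt gives k + 2 lattice points with pairwise differences below \<beta>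
  in every coordinate. Adding to \<beta> their differences from the one of largest coordinate sum
  yields k + 1 new positive lattice points of sum at most 1. Sum 1 would mean \<beta> itself, so all
  of them are interior: one too many.\<close>

lemma det_mult_prod_le: "\<bar>det V\<bar> * (\<Prod>i\<in>UNIV. \<beta> $ i) \<le> real (card (interior_coords V)) + 1"
proof (rule ccontr)
  define k where "k = card (interior_coords V)"
  assume "\<not> ?thesis"
  then have gt: "real (Suc k) < \<bar>det V\<bar> * (\<Prod>i\<in>UNIV. \<beta> $ i)"
    by (simp add: k_def)
  obtain B where B: "V ** B = mat 1" "B ** V = mat 1"
    using det_V invertible_det_nz unfolding invertible_def by blast
  have "det V * det B = 1"
    using B(1) by (metis det_I det_mul)
  then have "det B = 1 / det V"
    using det_V by (simp add: eq_divide_eq mult.commute)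
  then have detB: "det B \<noteq> 0" "\<bar>det B\<bar> = 1 / \<bar>det V\<bar>"
    using det_V by simp_all
  have less: "real (Suc k) * \<bar>det B\<bar> < (\<Prod>i\<in>UNIV. \<beta> $ i)"
    using gt det_V by (simp add: detB pos_divide_less_eq mult.commute)
  obtain Z where Z: "finite Z" "card Z = Suc (Suc k)" "Z \<subseteq> int_lattice"
    and bd: "\<And>z z' i. z \<in> Z \<Longrightarrow> z' \<in> Z \<Longrightarrow> \<bar>(B *v (z - z')) $ i\<bar> < \<beta> $ i"
    using blichfeldt_linear_forms [OF detB(1) beta(2) less] by blast
  define h where "h z = (\<Sum>i\<in>UNIV. (B *v z) $ i)" for z
  have "Max (h ` Z) \<in> h ` Z"
    using Z by (intro Max_in) auto
  then obtain z0 where "z0 \<in> Z" "h z0 = Max (h ` Z)"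
    by auto
  then have z0: "z0 \<in> Z" "\<And>z. z \<in> Z \<Longrightarrow> h z \<le> h z0"
    using Z(1) by simp_all
  define q where "q z = \<beta> + B *v (z - z0)" for z
  have VB: "V *v (B *v x) = x" for x
    by (simp add: matrix_vector_mul_assoc B)
  have "q z \<in> interior_coords V" if z: "z \<in> Z - {z0}" for z
  proof -
    have "q z \<in> lattice_coords V"
      using beta(1) z z0 Z(3) by (auto simp: q_def lattice_coords_def VB matrix_vector_right_distrib)
    moreover have pos: "0 < q z $ i" for i
      using bd [of z z0 i] z z0 by (auto simp: q_def)
    moreover have sum: "(\<Sum>i\<in>UNIV. q z $ i) = 1 + (h z - h z0)"
      by (simp add: q_def h_def sum.distrib beta matrix_vector_mult_diff_distrib sum_subtractf)
    moreover have "h z \<noteq> h z0"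
    proof
      assume "h z = h z0"
      then have "q z = \<beta>"
        using \<open>q z \<in> lattice_coords V\<close> pos sum by (intro facet_coords_unique) auto
      then have "V *v (B *v (z - z0)) = 0"
        by (simp add: q_def)
      then show False
        using z by (simp add: VB)
    qed
    ultimately show ?thesis
      using z0(2) [of z] z by (simp add: interior_coords_def)
  qed
  moreover have "inj_on q (Z - {z0})"
  proof (rule inj_onI)
    fix x y assume "q x = q y"
    then have "V *v (B *v (x - z0)) = V *v (B *v (y - z0))"
      by (simp add: q_def)
    then show "x = y"
      by (simp add: VB)
  qed
  ultimately have "card (Z - {z0}) \<le> card (interior_coords V)"
    using finite_interior_coords [OF det_V] by (meson card_inj_on_le image_subsetI)
  then show False
    using Z z0 by (simp add: k_def)
qed

text \<open>This applies Blichfeldt's theorem to the lattice generated by the vectors \<open>\<beta> - e i\<close> for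
  \<open>i \<in> J\<close>, of covolume \<open>1 - \<Sum>_J \<beta>\<close>; the coordinates outside \<open>J\<close> are padded with unit vectors to
  stay in dimension \<open>d\<close>.\<close>

lemma prod_le_sum_compl:
  assumes "J \<noteq> UNIV"
  shows "(\<Prod>i\<in>J. \<beta> $ i) \<le> 1 - (\<Sum>i\<in>J. \<beta> $ i)"
proof (rule ccontr)
  assume neg: "\<not> ?thesis"
  \<comment> \<open>An index outside J makes the determinant 1 - \<Sum>_J \<beta> positive; at the
    end, coordinate l of w vanishes and forces m = 0.\<close>
  obtain l where l: "l \<notin> J"
    using assms by blast
  define x y :: "real ^ 'n" where "x = (\<chi> i. if i \<in> J then \<beta> $ i else 0)" and "y = (\<chi> i. if i \<in> J then 1 else 0)"
  \<comment> \<open>\<open>A *v w\<close> is the combination with coefficients w of the vectors e_i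
    - x for i in J and e_i for i outside J, x being \<beta> cut off to J.\<close>
  define A where "A = (\<chi> i j. mat 1 $ i $ j - x $ i * y $ j)"
  have A: "(A *v w) $ i = w $ i - x $ i * (\<Sum>j\<in>J. w $ j)" for w i
  proof -
    have "(A *v w) $ i = (mat 1 *v w) $ i - x $ i * (\<Sum>j\<in>UNIV. y $ j * w $ j)"
      by (simp add: A_def matrix_vector_mult_def left_diff_distrib sum_subtractf sum_distrib_left
          mult.assoc del: matrix_vector_mul_lid)
    also have "(\<Sum>j\<in>UNIV. y $ j * w $ j) = (\<Sum>j\<in>J. w $ j)"
      by (rule sum.mono_neutral_cong_right) (auto simp: y_def)
    finally show ?thesis
      by simp
  qed
  have "(\<Sum>i\<in>UNIV. x $ i * y $ i) = (\<Sum>i\<in>J. \<beta> $ i)"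
    by (rule sum.mono_neutral_cong_right) (auto simp: x_def y_def)
  then have det: "det A = 1 - (\<Sum>i\<in>J. \<beta> $ i)"
    unfolding A_def by (simp only: det_diff_rank_one)
  have "(\<Sum>i\<in>J. \<beta> $ i) < (\<Sum>i\<in>UNIV. \<beta> $ i)"
    using l beta(2) by (intro sum_strict_mono2 [of _ _ l]) (auto intro: less_imp_le)
  then have pos: "det A > 0"
    by (simp add: det beta)
  \<comment> \<open>Outside J the bound 1 leaves only 0 for the integer coordinates of w, and it
    does not change the product.\<close>
  define c where "c i = (if i \<in> J then \<beta> $ i else 1)" for i
  have "(\<Prod>i\<in>UNIV. c i) = (\<Prod>i\<in>J. \<beta> $ i)"
    by (simp add: c_def prod.If_cases)
  then have "real 1 * \<bar>det A\<bar> < (\<Prod>i\<in>UNIV. c i)"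
    using neg pos det by simp
  moreover have "c i > 0" for i
    by (simp add: c_def beta)
  ultimately obtain Z where Z: "finite Z" "card Z = Suc 1" "Z \<subseteq> int_lattice"
    and bd: "\<And>z z' i. z \<in> Z \<Longrightarrow> z' \<in> Z \<Longrightarrow> \<bar>(A *v (z - z')) $ i\<bar> < c i"
    using blichfeldt_linear_forms [of A c 1] pos by (metis less_irrefl)
  obtain z z' where zz: "z \<in> Z" "z' \<in> Z" "z \<noteq> z'"
    using Z(1,2) by (metis card_2_iff insert_iff numeral_2_eq_2 One_nat_def)
  \<comment> \<open>Negating the difference if necessary makes its sum m over J nonpositive, which
    keeps the coordinates (1 - m) \<beta> of the later q outside J positive.\<close>
  have "\<exists>w\<in>int_lattice. w \<noteq> 0 \<and> (\<forall>i. \<bar>(A *v w) $ i\<bar> < c i) \<and> (\<Sum>j\<in>J. w $ j) \<le> 0"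
  proof (cases "(\<Sum>j\<in>J. (z - z') $ j) \<le> 0")
    case True
    then show ?thesis
      using zz Z(3) bd by (intro bexI [of _ "z - z'"]) auto
  next
    case False
    then show ?thesis
      using zz Z(3) bd by (intro bexI [of _ "z' - z"]) (auto simp: sum_subtractf)
  qed
  then obtain w where w: "w \<in> int_lattice" "w \<noteq> 0" "\<And>i. \<bar>(A *v w) $ i\<bar> < c i"
    and m: "(\<Sum>j\<in>J. w $ j) \<le> 0"
    by blast
  define m where "m = (\<Sum>j\<in>J. w $ j)"
  have w_int: "w $ i \<in> \<int>" for i
    using w(1) by (simp add: int_lattice_def)
  then have m_int: "m \<in> \<int>"
    by (auto simp: m_def)
  have w0: "w $ i = 0" if "i \<notin> J" for i
    using w(3) [of i] that w_int [of i] Ints_nonzero_abs_less1 by (auto simp: A c_def x_def)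
  define q where "q = \<beta> + (w - m *\<^sub>R \<beta>)"
  have "q = \<beta>"
  proof (rule facet_coords_unique)
    show "q \<in> lattice_coords V"
      unfolding q_def using w(1) m_int beta(1) int_lattice_coords by blast
    show "0 < q $ i" for i
    proof (cases "i \<in> J")
      case True
      then show ?thesis
        using w(3) [of i] by (simp add: q_def A c_def x_def m_def mult.commute)
    next
      case False
      have "m \<le> 0"
        using m by (simp add: m_def)
      then show ?thesis
        using beta(2) [of i] False w0 by (simp add: q_def)
    qed
    have "(\<Sum>i\<in>UNIV. w $ i) = m"
      unfolding m_def using w0 by (intro sum.mono_neutral_right) auto
    then show "(\<Sum>i\<in>UNIV. q $ i) = 1"
      by (simp add: q_def sum.distrib sum_subtractf beta flip: sum_distrib_left)
  qed
  then have w_eq: "w = m *\<^sub>R \<beta>"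
    by (simp add: q_def)
  then have "m = 0"
    using w0 [OF l] beta(2) [of l] by simp
  then show False
    using w_eq w(2) by simp
qed

end

section \<open>From the subset inequalities to the Sylvester bound\<close>

lemma ex_decreasing_enumeration:
  fixes f :: "'n::finite \<Rightarrow> real"
  obtains c where "bij_betw c {1..CARD('n)} UNIV"
    "\<And>i j. 1 \<le> i \<Longrightarrow> i \<le> j \<Longrightarrow> j \<le> CARD('n) \<Longrightarrow> f (c j) \<le> f (c i)"
proof -
  obtain ys :: "'n list" where ys: "set ys = UNIV" "distinct ys"
    using finite_distinct_list [OF finite_class.finite_UNIV] by blast
  define xs where "xs = sort_key (\<lambda>i. - f i) ys"
  have xs: "set xs = UNIV" "distinct xs" "length xs = CARD('n)"
    using ys distinct_card [of ys] by (auto simp: xs_def)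
  have "sorted (map (\<lambda>i. - f i) xs)"
    by (simp add: xs_def)
  then have dec: "f (xs ! j) \<le> f (xs ! i)" if "i \<le> j" "j < CARD('n)" for i j
    using that xs(3) sorted_nth_mono [of "map (\<lambda>i. - f i) xs" i j] by simp
  have "bij_betw ((!) xs) {..<CARD('n)} UNIV"
    using bij_betw_nth [of xs "{..<CARD('n)}"] xs by simp
  moreover have "bij_betw (\<lambda>i. i - 1) {1..CARD('n)} {..<CARD('n)}"
    by (rule bij_betw_byWitness [where f' = Suc]) auto
  ultimately have "bij_betw ((!) xs \<circ> (\<lambda>i. i - 1)) {1..CARD('n)} UNIV"
    by (rule bij_betw_trans [rotated])
  then show thesis
    using dec by (intro that [of "(!) xs \<circ> (\<lambda>i. i - 1)"]) (auto simp: less_eq_Suc_le)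
qed

text \<open>In decreasing order, an initial segment short of all coordinates is indexed by a proper
  subset, so \<open>prod_le_sum_compl\<close> supplies the product hypothesis of
  \<open>prod_ge_sylvester\<close>.\<close>

lemma (in unique_facet_point) prod_beta_ge:
  defines "N \<equiv> real (sylvester CARD('n)) - 1"
  obtains c where "bij_betw c {1..CARD('n)} UNIV" "1 / N\<^sup>2 \<le> (\<Prod>i\<in>UNIV. \<beta> $ i)"
    "1 / N\<^sup>2 = (\<Prod>i\<in>UNIV. \<beta> $ i) \<Longrightarrow>
       (\<forall>i\<in>{1..<CARD('n)}. \<beta> $ c i = 1 / sylvester i) \<and> \<beta> $ c CARD('n) = 1 / N"
proof -
  obtain c where c: "bij_betw c {1..CARD('n)} UNIV"
    and dec: "\<And>i j. 1 \<le> i \<Longrightarrow> i \<le> j \<Longrightarrow> j \<le> CARD('n) \<Longrightarrow> \<beta> $ c j \<le> \<beta> $ c i"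
    using ex_decreasing_enumeration [of "vec_nth \<beta>"] by blast
  have inj: "inj_on c {1..m}" if "m \<le> CARD('n)" for m
    using c that by (auto simp: bij_betw_def intro: inj_on_subset)
  have sums: "(\<Sum>i=1..m. \<beta> $ c i) = (\<Sum>i\<in>c ` {1..m}. \<beta> $ i)"
    and prods: "(\<Prod>i=1..m. \<beta> $ c i) = (\<Prod>i\<in>c ` {1..m}. \<beta> $ i)" if "m \<le> CARD('n)" for m
    using inj [OF that] by (simp_all add: sum.reindex prod.reindex)
  have im: "c ` {1..CARD('n)} = UNIV"
    using c by (simp add: bij_betw_def)
  have part: "(\<Prod>i=1..m. \<beta> $ c i) \<le> 1 - (\<Sum>i=1..m. \<beta> $ c i)" if "m < CARD('n)" for m
  proof -
    have "card (c ` {1..m}) = m"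
      using inj [of m] that by (simp add: card_image)
    then have "c ` {1..m} \<noteq> UNIV"
      using that by auto
    then show ?thesis
      using prod_le_sum_compl sums [of m] prods [of m] that by simp
  qed
  have tot: "(\<Sum>i=1..CARD('n). \<beta> $ c i) = 1"
    using sums [OF order_refl] beta(3) unfolding im by simp
  have P: "(\<Prod>i=1..CARD('n). \<beta> $ c i) = (\<Prod>i\<in>UNIV. \<beta> $ i)"
    using prods [OF order_refl] unfolding im by simp
  have "1 \<le> CARD('n)"
    by (simp add: Suc_le_eq)
  note * = prod_ge_sylvester [of "CARD('n)" "\<lambda>i. \<beta> $ c i", OF this beta(2) dec part tot, unfolded P, folded N_def]
  show thesis
    by (rule that [OF c]) (use * in auto)
qed

section \<open>Rigidity of the extremal case\<close>

lemma abs_eq_1_of_Ints_mult_eq_1: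
  fixes x y :: real
  assumes "x \<in> \<int>" "y \<in> \<int>" "x * y = 1"
  shows "\<bar>x\<bar> = 1"
proof -
  obtain a b :: int where ab: "x = a" "y = b"
    using assms(1,2) by (auto elim!: Ints_cases)
  then have "real_of_int (a * b) = 1"
    using assms(3) by simp
  then have "a * b = 1"
    by linarith
  then have "\<bar>a\<bar> = 1"
    by (intro abs_zmult_eq_1 [of a b]) simp
  then show ?thesis
    by (simp add: ab flip: of_int_abs)
qed

text \<open>In edge coordinates \<open>axis i 1 - axis r 1\<close> is the facet edge from vertex r
  to vertex i. In the extremal case these edges divided by \<open>t i\<close> form a basis of the
  lattice of facet directions.\<close>

definition frame_vec :: "'n::finite \<Rightarrow> ('n \<Rightarrow> nat) \<Rightarrow> 'n \<Rightarrow> real ^ 'n" where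
  "frame_vec r t i = (1 / real (t i)) *\<^sub>R (axis i 1 - axis r 1)"

lemma frame_vec_nth: "j \<noteq> r \<Longrightarrow> frame_vec r t i $ j = (if i = j then 1 / real (t i) else 0)"
  by (auto simp: frame_vec_def axis_def)

lemma sum_frame_vec: "(\<Sum>j\<in>UNIV. frame_vec r t i $ j) = 0"
  by (simp add: frame_vec_def axis_def sum_subtractf flip: sum_divide_distrib)

lemma frame_comb_nth:
  assumes "j \<noteq> r"
  shows "(\<Sum>i\<in>-{r}. a i *\<^sub>R frame_vec r t i) $ j = a j / real (t j)"
  using assms by (simp add: frame_vec_nth if_distrib cong: if_cong)

lemma sum_frame_comb: "(\<Sum>j\<in>UNIV. (\<Sum>i\<in>A. a i *\<^sub>R frame_vec r t i) $ j) = 0"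
proof -
  have "(\<Sum>j\<in>UNIV. (\<Sum>i\<in>A. a i *\<^sub>R frame_vec r t i) $ j) =
      (\<Sum>i\<in>A. \<Sum>j\<in>UNIV. a i * frame_vec r t i $ j)"
    by (simp add: sum.swap [of _ A])
  also have "\<dots> = 0"
    by (simp add: sum_frame_vec flip: sum_distrib_left)
  finally show ?thesis .
qed

lemma vec_eq_by_sum:
  fixes x y :: "real ^ 'n"
  assumes "\<And>i. i \<noteq> r \<Longrightarrow> x $ i = y $ i" "(\<Sum>i\<in>UNIV. x $ i) = (\<Sum>i\<in>UNIV. y $ i)"
  shows "x = y"
proof -
  have "(\<Sum>i\<in>-{r}. x $ i) = (\<Sum>i\<in>-{r}. y $ i)"
    using assms(1) by (intro sum.cong) auto
  then have "x $ r = y $ r"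
    using assms(2) by (simp add: sum.remove [of UNIV r] Compl_eq_Diff_UNIV)
  then show ?thesis
    using assms(1) by (metis vec_eq_iff)
qed

lemma frame_expansion:
  assumes t: "\<And>i. t i > 0"
  shows "x = (\<Sum>i\<in>-{r}. (real (t i) * x $ i) *\<^sub>R frame_vec r t i) + (\<Sum>i\<in>UNIV. x $ i) *\<^sub>R axis r 1"
proof (rule vec_eq_by_sum)
  show "x $ j = ((\<Sum>i\<in>-{r}. (real (t i) * x $ i) *\<^sub>R frame_vec r t i) + (\<Sum>i\<in>UNIV. x $ i) *\<^sub>R axis r 1) $ j"
    if "j \<noteq> r" for j
    using that t [of j] unfolding vector_add_component frame_comb_nth [OF that] by (simp add: axis_def)
  show "(\<Sum>j\<in>UNIV. x $ j) = (\<Sum>j\<in>UNIV. ((\<Sum>i\<in>-{r}. (real (t i) * x $ i) *\<^sub>R frame_vec r t i) +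
      (\<Sum>i\<in>UNIV. x $ i) *\<^sub>R axis r 1) $ j)"
    unfolding vector_add_component sum.distrib sum_frame_comb
    by (simp add: axis_def flip: sum_distrib_left)
qed

definition frame_matrix :: "'n::finite \<Rightarrow> ('n \<Rightarrow> nat) \<Rightarrow> real ^ 'n \<Rightarrow> real ^ 'n ^ 'n" where
  "frame_matrix r t u = (\<chi> i j. if j = r then u $ i else frame_vec r t j $ i)"

lemma frame_matrix_mult:
  "frame_matrix r t u *v x = (\<Sum>i\<in>-{r}. x $ i *\<^sub>R frame_vec r t i) + x $ r *\<^sub>R u"
proof -
  have "(frame_matrix r t u *v x) $ j = ((\<Sum>i\<in>-{r}. x $ i *\<^sub>R frame_vec r t i) + x $ r *\<^sub>R u) $ j" for j
  proof -
    have "(frame_matrix r t u *v x) $ j =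
        (\<Sum>i\<in>UNIV - {r}. frame_matrix r t u $ j $ i * x $ i) + frame_matrix r t u $ j $ r * x $ r"
      by (simp add: matrix_vector_mult_def sum.remove [of UNIV r])
    also have "(\<Sum>i\<in>UNIV - {r}. frame_matrix r t u $ j $ i * x $ i) = (\<Sum>i\<in>-{r}. x $ i * frame_vec r t i $ j)"
      by (intro sum.cong) (auto simp: frame_matrix_def)
    finally show ?thesis
      by (simp add: frame_matrix_def)
  qed
  then show ?thesis
    by (simp add: vec_eq_iff)
qed

text \<open>Cramer's rule twice: subtracting all other rows of the diagonal matrix T from row r
  gives the frame matrix with column \<open>axis r 1\<close>; then column r is replaced by u, whose
  coefficient at r in this frame is its coordinate sum.\<close>

lemma det_frame_matrix:
  assumes t: "\<And>i. t i > 0"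
  shows "det (frame_matrix r t u) = (\<Sum>i\<in>UNIV. u $ i) / (\<Prod>i\<in>-{r}. real (t i))"
proof -
  define T :: "real ^ 'a ^ 'a" where "T = (\<chi> i j. if i = j then (if i = r then 1 else 1 / real (t i)) else 0)"
  define x :: "real ^ 'a" where "x = (\<chi> i. if i = r then 1 else - 1)"
  let ?G = "frame_matrix r t (axis r 1)"
  have "det T = (\<Prod>i\<in>UNIV. if i = r then 1 else 1 / real (t i))"
    by (subst det_diagonal) (auto simp: T_def)
  also have "\<dots> = (\<Prod>i\<in>-{r}. 1 / real (t i))"
    by (rule prod.mono_neutral_cong_right) auto
  finally have T: "det T = 1 / (\<Prod>i\<in>-{r}. real (t i))"
    by (simp add: prod_dividef)
  have row: "(\<Sum>i\<in>UNIV. x $ i *s row i T) $ j = ?G $ r $ j" for j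
  proof -
    have "(\<Sum>i\<in>UNIV. x $ i *s row i T) $ j = (\<Sum>i\<in>UNIV. if i = j then x $ i * T $ i $ i else 0)"
      unfolding sum_component by (intro sum.cong) (auto simp: row_def T_def)
    also have "\<dots> = ?G $ r $ j"
      by (simp add: x_def T_def frame_matrix_def frame_vec_def axis_def)
    finally show ?thesis .
  qed
  have "?G = (\<chi> i. if i = r then (\<Sum>i\<in>UNIV. x $ i *s row i T) else row i T)"
    unfolding vec_eq_iff
  proof (intro allI)
    fix i j
    show "?G $ i $ j = (\<chi> i. if i = r then (\<Sum>i\<in>UNIV. x $ i *s row i T) else row i T) $ i $ j"
      using row [of j] by (auto simp: row_def T_def frame_matrix_def frame_vec_nth axis_def)
  qed
  then have G: "det ?G = det T"
    using cramer_lemma_transpose [of r x T] by (simp add: x_def)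
  define v :: "real ^ 'a" where "v = (\<chi> i. if i = r then (\<Sum>i\<in>UNIV. u $ i) else real (t i) * u $ i)"
  have "?G *v v = (\<Sum>i\<in>-{r}. (real (t i) * u $ i) *\<^sub>R frame_vec r t i) + (\<Sum>i\<in>UNIV. u $ i) *\<^sub>R axis r 1"
    unfolding frame_matrix_mult by (intro arg_cong2 [where f = "(+)"] sum.cong) (auto simp: v_def)
  also have "\<dots> = u"
    using frame_expansion [of t u r, OF t] by simp
  finally have "frame_matrix r t u = (\<chi> i j. if j = r then (?G *v v) $ i else ?G $ i $ j)"
    by (simp add: frame_matrix_def vec_eq_iff)
  then have "det (frame_matrix r t u) = v $ r * det ?G"
    using cramer_lemma [of r ?G v] by simp
  then show ?thesis
    by (simp add: G T v_def)
qed

text \<open>The shape of \<beta> forced by equality in \<open>prod_beta_ge\<close>. In dimension 2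
  both coordinates are 1 / 2, so \<beta> does not determine r; hence the exceptional case of
  \<open>extremal_apex\<close>.\<close>

locale unit_fraction_point = unique_facet_point V \<beta>
  for V :: "real ^ 'n ^ 'n" and \<beta> :: "real ^ 'n" +
  fixes r :: 'n and t :: "'n \<Rightarrow> nat" and N :: real
  assumes t_ge_2: "t i \<ge> 2"
    and N_eq: "N = (\<Prod>i\<in>-{r}. real (t i))"
    and beta_nth: "i \<noteq> r \<Longrightarrow> \<beta> $ i = 1 / real (t i)"
    and beta_root: "\<beta> $ r = 1 / N"
begin

lemma t_pos [simp]: "t i > 0" "t i \<noteq> 0"
  using t_ge_2 [of i] by auto

lemma N_pos: "N > 0"
  unfolding N_eq by (intro prod_pos) simp

lemma sum_unit_fractions: "(\<Sum>i\<in>-{r}. 1 / real (t i)) = 1 - 1 / N"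
proof -
  have "(\<Sum>i\<in>-{r}. \<beta> $ i) = 1 - 1 / N"
    using beta(3) beta_root by (simp add: sum.remove [of UNIV r] Compl_eq_Diff_UNIV)
  moreover have "(\<Sum>i\<in>-{r}. \<beta> $ i) = (\<Sum>i\<in>-{r}. 1 / real (t i))"
    by (intro sum.cong) (auto simp: beta_nth)
  ultimately show ?thesis
    by simp
qed

lemma axis_in_lattice [simp]: "axis i 1 \<in> lattice_coords V"
  by (intro int_lattice_coords) simp

text \<open>Multiplying the sum of the unit fractions by \<open>N\<close> shows that \<open>N / t i \<equiv> - 1\<close> modulo \<open>t i\<close>, so a
  suitable multiple of \<open>\<beta>\<close> isolates the \<open>i\<close>-th coordinate.\<close>

lemma frame_vec_in_lattice:
  assumes i: "i \<noteq> r"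
  shows "frame_vec r t i \<in> lattice_coords V"
proof -
  define M where "M = (\<Prod>j\<in>-{r} - {i}. real (t j))"
  have NM: "N = real (t i) * M"
    unfolding N_eq M_def using i by (simp add: prod.remove [of "-{r}" i])
  have M: "M \<in> \<int>" "M > 0"
    unfolding M_def by (auto intro!: Ints_prod prod_pos)
  have Mj: "M / real (t j) \<in> \<int>" if "j \<noteq> r" "j \<noteq> i" for j
    unfolding M_def using that by (subst prod.remove [of _ j]) (auto intro!: Ints_prod)
  have "1 / real (t i) + (\<Sum>j\<in>-{r} - {i}. 1 / real (t j)) = 1 - 1 / N"
    using sum_unit_fractions i by (simp add: sum.remove [of "-{r}" i])
  then have "M * (1 / real (t i) + (\<Sum>j\<in>-{r} - {i}. 1 / real (t j))) = M * (1 - 1 / N)"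
    by simp
  then have "(M + 1) / real (t i) = M - (\<Sum>j\<in>-{r} - {i}. M / real (t j))"
    using M(2) by (simp add: NM algebra_simps sum_distrib_left add_divide_distrib)
  moreover have "(\<Sum>j\<in>-{r} - {i}. M / real (t j)) \<in> \<int>"
    using Mj by (intro Ints_sum) auto
  ultimately have Mi: "(M + 1) / real (t i) \<in> \<int>"
    using M by simp
  \<comment> \<open>With M = N / \<open>t i\<close>, coordinate i becomes (M + 1) /
    \<open>t i\<close>, the others off r become M / \<open>t j\<close>, and at r the fractions
    cancel because M / N = 1 / \<open>t i\<close>. So x is integral.\<close>
  define x where "x = frame_vec r t i + M *\<^sub>R (\<beta> - axis r 1)"
  have "x $ j \<in> \<int>" for j
  proof -
    consider "j = r" | "j = i" | "j \<noteq> r" "j \<noteq> i"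
      by blast
    then show ?thesis
    proof cases
      case 1
      have "x $ j = - M"
        using i 1 M(2) by (simp add: x_def frame_vec_def beta_root NM axis_def algebra_simps)
      then show ?thesis
        using M by simp
    next
      case 2
      then show ?thesis
        using i Mi by (simp add: x_def frame_vec_nth beta_nth axis_def add_divide_distrib add.commute)
    next
      case 3
      then show ?thesis
        using Mj by (simp add: x_def frame_vec_nth beta_nth axis_def)
    qed
  qed
  then have "x \<in> lattice_coords V"
    by (intro int_lattice_coords) (simp add: int_lattice_def)
  then have "x - M *\<^sub>R (\<beta> - axis r 1) \<in> lattice_coords V"
    using M(1) beta(1) by (intro lattice_coords_simps) auto
  then show ?thesis
    by (simp add: x_def)
qed

lemma frame_comb_in_lattice:
  assumes "\<And>i. i \<noteq> r \<Longrightarrow> a i \<in> \<int>"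
  shows "(\<Sum>i\<in>-{r}. a i *\<^sub>R frame_vec r t i) \<in> lattice_coords V"
  using assms frame_vec_in_lattice by (intro lattice_coords_sum lattice_coords_simps) auto

text \<open>Reducing \<^term>\<open>x\<close> modulo the frame vectors yields a point whose coordinates away from
  \<^term>\<open>r\<close> are positive and at most those of \<^term>\<open>\<beta>\<close>.\<close>

definition reduce :: "real ^ 'n \<Rightarrow> real ^ 'n" where
  "reduce x = axis r 1 + x - (\<Sum>i\<in>-{r}. of_int (\<lceil>real (t i) * x $ i\<rceil> - 1) *\<^sub>R frame_vec r t i)"

lemma reduce_in_lattice: "x \<in> lattice_coords V \<Longrightarrow> reduce x \<in> lattice_coords V"
  unfolding reduce_def by (intro lattice_coords_simps frame_comb_in_lattice) auto

lemma reduce_nth: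
  "i \<noteq> r \<Longrightarrow> reduce x $ i = (real (t i) * x $ i - of_int \<lceil>real (t i) * x $ i\<rceil> + 1) / real (t i)"
  unfolding reduce_def vector_minus_component vector_add_component
  by (subst frame_comb_nth) (auto simp: axis_def field_simps)

text \<open>Subtracting the ceiling minus 1 instead of the floor leaves a remainder in (0, 1]
  instead of [0, 1): the reduced coordinate is positive, and multiples of 1 / \<open>t i\<close>
  reduce to 1 / \<open>t i\<close>, the value of \<beta>.\<close>

lemma reduce_nth_bounds:
  assumes "i \<noteq> r"
  shows "0 < reduce x $ i" "reduce x $ i \<le> 1 / real (t i)"
proof -
  have "0 < real (t i) * x $ i - of_int \<lceil>real (t i) * x $ i\<rceil> + 1"
    by linarith
  then show "0 < reduce x $ i"
    unfolding reduce_nth [OF assms] by (intro divide_pos_pos) auto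
  show "reduce x $ i \<le> 1 / real (t i)"
    unfolding reduce_nth [OF assms] by (intro divide_right_mono) auto
qed

lemma sum_reduce: "(\<Sum>i\<in>UNIV. reduce x $ i) = 1 + (\<Sum>i\<in>UNIV. x $ i)"
  unfolding reduce_def vector_minus_component vector_add_component sum_subtractf sum.distrib sum_frame_comb
  by (simp add: axis_def)

lemma reduce_root: "reduce x $ r = 1 + (\<Sum>i\<in>UNIV. x $ i) - (\<Sum>i\<in>-{r}. reduce x $ i)"
  using sum_reduce [of x] by (simp add: sum.remove [of UNIV r] Compl_eq_Diff_UNIV)

text \<open>The coordinates off r add up to at most 1 - 1 / N, and the rest of the coordinate sum
  falls to r.\<close>

lemma reduce_root_ge: "reduce x $ r \<ge> 1 / N + (\<Sum>i\<in>UNIV. x $ i)"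
proof -
  have "(\<Sum>i\<in>-{r}. reduce x $ i) \<le> (\<Sum>i\<in>-{r}. 1 / real (t i))"
    using reduce_nth_bounds by (intro sum_mono) auto
  then show ?thesis
    unfolding reduce_root sum_unit_fractions by simp
qed

text \<open>A lattice vector of coordinate sum 0 reduces to a positive lattice point on the facet,
  that is, to \<beta>; its coordinates 1 / \<open>t i\<close> show that the ceilings were exact. So
  the frame vectors generate all lattice directions of the facet.\<close>

lemma frame_coord_Ints:
  assumes x: "x \<in> lattice_coords V" "(\<Sum>i\<in>UNIV. x $ i) = 0" and i: "i \<noteq> r"
  shows "real (t i) * x $ i \<in> \<int>"
proof -
  have "0 < reduce x $ r"
    using reduce_root_ge [of x] x N_pos by (simp add: less_le_trans [of _ "1 / N"])
  then have "reduce x = \<beta>"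
    using reduce_in_lattice [OF x(1)] reduce_nth_bounds(1) sum_reduce [of x] x
    by (intro facet_coords_unique) (metis, metis, simp)
  then have "real (t i) * x $ i = of_int \<lceil>real (t i) * x $ i\<rceil>"
    using reduce_nth [OF i, of x] beta_nth [OF i] by simp
  then show ?thesis
    by (metis Ints_of_int)
qed

lemma det_mult_nth_Ints:
  assumes "x \<in> lattice_coords V"
  shows "det V * x $ i \<in> \<int>"
proof -
  have "x = (\<chi> k. det (\<chi> i j. if j = k then (V *v x) $ i else V $ i $ j) / det V)"
    using cramer [OF det_V, of x "V *v x"] by simp
  then have "x $ i = det (\<chi> i' j. if j = i then (V *v x) $ i' else V $ i' $ j) / det V"
    by (metis (no_types, lifting) vec_lambda_beta)
  then have "det V * x $ i = det (\<chi> i' j. if j = i then (V *v x) $ i' else V $ i' $ j)"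
    using det_V by simp
  also have "\<dots> \<in> \<int>"
    using assms V_int by (intro det_Ints) (auto simp: lattice_coords_def int_lattice_def)
  finally show ?thesis .
qed

text \<open>The coordinate sums of lattice vectors, scaled by |det V|, form a group of integers,
  generated by its least positive element g. Hence the sums are the multiples of 1 / h for h = |det
  V| / g, the lattice height of the apex over the facet, and u moves by one layer from the facet
  towards the apex.\<close>

lemma ex_height_one:
  obtains u h where "h > 0" "u \<in> lattice_coords V" "(\<Sum>i\<in>UNIV. u $ i) = - 1 / real h"
    "\<forall>x\<in>lattice_coords V. real h * (\<Sum>i\<in>UNIV. x $ i) \<in> \<int>"
proof -
  define \<sigma> where "\<sigma> x = \<bar>det V\<bar> * (\<Sum>i\<in>UNIV. x $ i)" for x :: "real ^ 'n"
  have \<sigma>_Ints: "\<sigma> x \<in> \<int>" if "x \<in> lattice_coords V" for x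
  proof -
    have "(\<Sum>i\<in>UNIV. det V * x $ i) \<in> \<int>"
      using that det_mult_nth_Ints by (intro Ints_sum) auto
    then show ?thesis
      by (auto simp: \<sigma>_def abs_if simp flip: sum_distrib_left)
  qed
  have \<sigma>_axis: "\<sigma> (axis r 1) = \<bar>det V\<bar>"
    by (simp add: \<sigma>_def axis_def)
  have \<sigma>_diff: "\<sigma> (x - c *\<^sub>R y) = \<sigma> x - c * \<sigma> y" for x y c
    by (simp add: \<sigma>_def sum_subtractf algebra_simps sum_distrib_left)
  define P where "P n \<longleftrightarrow> n > 0 \<and> (\<exists>x\<in>lattice_coords V. \<sigma> x = real n)" for n
  obtain D where D: "\<bar>det V\<bar> = real D"
    using \<sigma>_Ints [OF axis_in_lattice [of r]] unfolding \<sigma>_axis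
    by (metis Ints_cases abs_ge_zero of_int_0_le_iff of_int_of_nat_eq nonneg_int_cases)
  have "D > 0"
    using D det_V by (metis abs_eq_0 gr0I of_nat_0)
  then have "P D"
    using D \<sigma>_axis unfolding P_def by (auto intro!: bexI [of _ "axis r 1"])
  define g where "g = (LEAST n. P n)"
  have "P g"
    unfolding g_def by (rule LeastI) fact
  then obtain x0 where g: "g > 0" and x0: "x0 \<in> lattice_coords V" "\<sigma> x0 = real g"
    unfolding P_def by blast
  have dvd: "\<exists>z::int. \<sigma> x = z * real g" if x: "x \<in> lattice_coords V" for x
  proof -
    obtain z where z: "\<sigma> x = of_int z"
      using \<sigma>_Ints [OF x] by (auto elim: Ints_cases)
    define y where "y = x - of_int (z div int g) *\<^sub>R x0"
    have "\<sigma> y = of_int (z - z div int g * int g)"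
      by (simp add: y_def \<sigma>_diff z x0)
    then have \<sigma>_y: "\<sigma> y = of_int (z mod int g)"
      by (simp add: minus_div_mult_eq_mod)
    have y: "y \<in> lattice_coords V"
      unfolding y_def using x x0 by (intro lattice_coords_simps) auto
    have "z mod int g = 0"
    proof (rule ccontr)
      assume "z mod int g \<noteq> 0"
      then have "0 < z mod int g" "z mod int g < int g"
        using g pos_mod_sign [of "int g" z] pos_mod_bound [of "int g" z] by linarith+
      then have "P (nat (z mod int g))" "nat (z mod int g) < g"
        using y \<sigma>_y unfolding P_def by auto
      then show False
        unfolding g_def using not_less_Least by blast
    qed
    then show ?thesis
      using z by (intro exI [of _ "z div int g"]) (metis div_mult_mod_eq add.right_neutral of_int_mult of_int_of_nat_eq)
  qed
  obtain z where z: "real D = of_int z * real g"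
    using dvd [OF axis_in_lattice [of r]] D \<sigma>_axis by auto
  then have "z > 0"
    using \<open>D > 0\<close> g by (metis of_int_0_less_iff of_nat_0_less_iff zero_less_mult_pos2)
  then have h: "real D = real (nat z) * real g"
    using z by simp
  show thesis
  proof (rule that [of "nat z" "- x0"])
    show "nat z > 0"
      using \<open>z > 0\<close> by simp
    show "- x0 \<in> lattice_coords V"
      using x0 by simp
    have sum: "(\<Sum>i\<in>UNIV. x $ i) = \<sigma> x / real D" for x
      using D \<open>D > 0\<close> by (simp add: \<sigma>_def)
    show "(\<Sum>i\<in>UNIV. (- x0) $ i) = - 1 / real (nat z)"
      using sum [of x0] x0 h g \<open>z > 0\<close> by (simp add: sum_negf field_simps)
    show "\<forall>x\<in>lattice_coords V. real (nat z) * (\<Sum>i\<in>UNIV. x $ i) \<in> \<int>"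
    proof
      fix x assume "x \<in> lattice_coords V"
      then obtain w :: int where "\<sigma> x = w * real g"
        using dvd by blast
      then have "real (nat z) * (\<Sum>i\<in>UNIV. x $ i) = of_int w"
        using g \<open>z > 0\<close> by (simp add: sum h)
      then show "real (nat z) * (\<Sum>i\<in>UNIV. x $ i) \<in> \<int>"
        by simp
    qed
  qed
qed

text \<open>The frame vectors and u form a basis W of the lattice, with |det W| = 1 / (h N).
  Therefore V W is integral with an integral right inverse K, and its determinant is 1 or
  -1.\<close>

lemma det_eq_height:
  assumes h: "h > 0" and u: "u \<in> lattice_coords V" "(\<Sum>i\<in>UNIV. u $ i) = - 1 / real h"
    and div: "\<forall>x\<in>lattice_coords V. real h * (\<Sum>i\<in>UNIV. x $ i) \<in> \<int>"
  shows "\<bar>det V\<bar> = real h * N"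
proof -
  define W where "W = frame_matrix r t u"
  have detW: "\<bar>det W\<bar> = 1 / (real h * N)"
    using N_pos by (simp add: W_def det_frame_matrix u flip: N_eq)
  have span: "\<exists>z\<in>int_lattice. W *v z = x" if x: "x \<in> lattice_coords V" for x
  proof -
    \<comment> \<open>\<open>a *\<^sub>R u\<close> has the coordinate sum of x, so the remainder y
      is a facet direction and \<open>frame_coord_Ints\<close> applies.\<close>
    define a where "a = - real h * (\<Sum>i\<in>UNIV. x $ i)"
    define y where "y = x - a *\<^sub>R u"
    have "a \<in> \<int>"
      using div x by (simp add: a_def)
    then have y: "y \<in> lattice_coords V"
      unfolding y_def using x u by (intro lattice_coords_simps)
    have "(\<Sum>i\<in>UNIV. y $ i) = (\<Sum>i\<in>UNIV. x $ i) - a * (\<Sum>i\<in>UNIV. u $ i)"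
      by (simp add: y_def sum_subtractf sum_distrib_left)
    also have "\<dots> = 0"
      using h by (simp add: u a_def)
    finally have y_eq: "y = (\<Sum>i\<in>-{r}. (real (t i) * y $ i) *\<^sub>R frame_vec r t i)"
      and y_Ints: "\<And>i. i \<noteq> r \<Longrightarrow> real (t i) * y $ i \<in> \<int>"
      using frame_expansion [of t y r] frame_coord_Ints [OF y] by auto
    define z :: "real ^ 'n" where "z = (\<chi> i. if i = r then a else real (t i) * y $ i)"
    have "W *v z = (\<Sum>i\<in>-{r}. (real (t i) * y $ i) *\<^sub>R frame_vec r t i) + a *\<^sub>R u"
      unfolding W_def frame_matrix_mult by (intro arg_cong2 [where f = "(+)"] sum.cong) (auto simp: z_def)
    also have "\<dots> = x"
      unfolding y_eq [symmetric] by (simp add: y_def)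
    finally have "W *v z = x" .
    moreover have "z \<in> int_lattice"
      using \<open>a \<in> \<int>\<close> y_Ints by (simp add: z_def int_lattice_def)
    ultimately show ?thesis
      by blast
  qed
  obtain B where B: "V ** B = mat 1"
    using det_V invertible_det_nz unfolding invertible_def by blast
  have "\<exists>z\<in>int_lattice. V *v (W *v z) = axis j 1" for j
  proof -
    have "B *v axis j 1 \<in> lattice_coords V"
      by (simp add: lattice_coords_def matrix_vector_mul_assoc B)
    from span [OF this] show ?thesis
      by (metis B matrix_vector_mul_assoc matrix_vector_mul_lid)
  qed
  then obtain Z where Z: "\<And>j. Z j \<in> int_lattice" "\<And>j. V *v (W *v Z j) = axis j 1"
    by metis
  define K where "K = (\<chi> i j. Z j $ i)"
  have K: "K *v axis j 1 = Z j" for j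
    by (simp add: K_def matrix_vector_mult_basis column_def)
  have "(V ** W ** K) *v axis j 1 = mat 1 *v axis j 1" for j
    by (simp add: K Z flip: matrix_vector_mul_assoc)
  then have "column j (V ** W ** K) = column j (mat 1)" for j
    by (simp only: matrix_vector_mult_basis)
  then have "V ** W ** K = mat 1"
    by (simp add: column_def vec_eq_iff)
  then have det1: "det (V ** W) * det K = 1"
    by (metis det_I det_mul)
  have "(V ** W) $ i $ j \<in> \<int>" for i j
  proof -
    have "W *v axis j 1 \<in> lattice_coords V"
      using u frame_vec_in_lattice
      by (cases "j = r") (auto simp: W_def frame_matrix_mult axis_def if_distribR if_distrib cong: if_cong)
    then have "(V *v (W *v axis j 1)) $ i \<in> \<int>"
      by (simp add: lattice_coords_def int_lattice_def)
    then have "(V ** W *v axis j 1) $ i \<in> \<int>"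
      by (simp only: matrix_vector_mul_assoc)
    then show ?thesis
      by (simp add: matrix_vector_mult_basis column_def)
  qed
  then have "det (V ** W) \<in> \<int>" "det K \<in> \<int>"
    using Z(1) by (auto intro!: det_Ints simp: K_def int_lattice_def)
  then have "\<bar>det (V ** W)\<bar> = 1"
    using abs_eq_1_of_Ints_mult_eq_1 det1 by blast
  then show ?thesis
    using detW h N_pos by (simp add: det_mul abs_mult field_simps)
qed

lemma extremal_apex:
  assumes D: "\<bar>det V\<bar> = (real (card (interior_coords V)) + 1) * N\<^sup>2"
  defines "h \<equiv> (real (card (interior_coords V)) + 1) * N"
  shows "(1 / h) *\<^sub>R axis r 1 \<in> lattice_coords V \<or>
    (\<exists>i. i \<noteq> r \<and> UNIV = {r, i} \<and> N = real (t i) \<and> (1 / h) *\<^sub>R axis i 1 \<in> lattice_coords V)"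
proof -
  define k where "k = card (interior_coords V)"
  obtain u h' where h': "h' > 0" and u: "u \<in> lattice_coords V" "(\<Sum>i\<in>UNIV. u $ i) = - 1 / real h'"
    and div: "\<forall>x\<in>lattice_coords V. real h' * (\<Sum>i\<in>UNIV. x $ i) \<in> \<int>"
    by (rule ex_height_one)
  have hh': "real h' = h"
    using det_eq_height [OF h' u div] D N_pos by (simp add: h_def power2_eq_square)
  have h: "h > 0" "h = (real k + 1) * N"
    using N_pos by (auto simp: h_def k_def)
  have sum_u: "(\<Sum>i\<in>UNIV. u $ i) = - 1 / h"
    using u(2) hh' by simp
  \<comment> \<open>\<open>q j\<close> represents layer j modulo the frame vectors: its coordinate
    sum is 1 - j / h, and only coordinate r can fail to be positive.\<close>
  define q where "q j = reduce (real j *\<^sub>R u)" for j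
  have q_lattice: "q j \<in> lattice_coords V" for j
    unfolding q_def using u by (intro reduce_in_lattice lattice_coords_simps) auto
  have sum_mult_u: "(\<Sum>i\<in>UNIV. (real j *\<^sub>R u) $ i) = - real j / h" for j
    using sum_u by (simp flip: sum_distrib_left)
  have sum_q: "(\<Sum>i\<in>UNIV. q j $ i) = 1 - real j / h" for j
    unfolding q_def sum_reduce sum_mult_u by simp
  have q_interior: "q j \<in> interior_coords V" if "j \<ge> 1" "q j $ r > 0" for j
  proof -
    have "0 < q j $ i" for i
      using that reduce_nth_bounds(1) [of i] by (cases "i = r") (auto simp: q_def)
    then show ?thesis
      using that h sum_q [of j] q_lattice by (simp add: interior_coords_def)
  qed
  have inj: "inj q"
    using sum_q h by (intro injI) (metis diff_left_imp_eq divide_cancel_right less_irrefl of_nat_eq_iff diff_diff_eq2 diff_eq_eq add_diff_cancel_left')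
  \<comment> \<open>For j \<le> k the coordinate at r is at least 1 / N - j / h, which is positive
    because h = (k + 1) N.\<close>
  have low: "q ` {1..k} \<subseteq> interior_coords V"
  proof (intro image_subsetI q_interior)
    fix j assume j: "j \<in> {1..k}"
    then have "real j / h < (real k + 1) / h"
      using h by (intro divide_strict_right_mono) auto
    also have "(real k + 1) / h = 1 / N"
      unfolding h(2) by simp
    finally have "0 < 1 / N - real j / h"
      by simp
    also have "\<dots> \<le> q j $ r"
      using reduce_root_ge [of "real j *\<^sub>R u"] unfolding sum_mult_u q_def by simp
    finally show "0 < q j $ r" .
  qed auto
  \<comment> \<open>These k distinct points are all the interior points there are, so the
    representatives of later layers have a nonpositive coordinate at r.\<close>
  have "card (q ` {1..k}) = k"
    using inj by (simp add: card_image inj_on_subset [OF inj])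
  then have interior: "q ` {1..k} = interior_coords V"
    using low finite_interior_coords [OF det_V] by (intro card_subset_eq) (auto simp: k_def)
  have high: "1 - real j / h \<le> (\<Sum>i\<in>-{r}. q j $ i)" if "j > k" for j
  proof -
    have "q j \<notin> q ` {1..k}"
      using that inj by (auto dest: injD)
    then have "q j $ r \<le> 0"
      using q_interior [of j] that interior by force
    then show ?thesis
      using sum_q [of j] by (simp add: sum.remove [of UNIV r] Compl_eq_Diff_UNIV)
  qed
  define b where "b i = real (t i) * u $ i" for i
  have q_nth: "q j $ i = (real j * b i - of_int \<lceil>real j * b i\<rceil> + 1) / real (t i)" if "i \<noteq> r" for i j
    unfolding q_def reduce_nth [OF that] by (simp add: b_def mult.left_commute)
  \<comment> \<open>In layer k + 1 the coordinates off r must add up to at least 1 - 1 / N, the sum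
    of their upper bounds 1 / \<open>t i\<close>. So every bound is attained, which makes the
    ceiling of (k + 1) \<open>b i\<close> exact.\<close>
  have kb: "(real k + 1) * b i \<in> \<int>" if i: "i \<noteq> r" for i
  proof -
    have "(\<Sum>i\<in>-{r}. 1 / real (t i) - q (Suc k) $ i) \<le> 0"
      using high [of "Suc k"] N_pos unfolding sum_subtractf sum_unit_fractions h(2) by (simp add: add.commute)
    moreover have nonneg: "0 \<le> 1 / real (t i) - q (Suc k) $ i" if "i \<in> -{r}" for i
      using reduce_nth_bounds(2) [of i] that by (simp add: q_def)
    ultimately have "1 / real (t i) - q (Suc k) $ i = 0"
      using i sum_nonneg_eq_0_iff [of "-{r}" "\<lambda>i. 1 / real (t i) - q (Suc k) $ i"]
        sum_nonneg [of "-{r}" "\<lambda>i. 1 / real (t i) - q (Suc k) $ i"] by force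
    then have "1 / real (t i) = (real (Suc k) * b i - of_int \<lceil>real (Suc k) * b i\<rceil> + 1) / real (t i)"
      unfolding q_nth [OF i] by simp
    then have "real (Suc k) * b i = of_int \<lceil>real (Suc k) * b i\<rceil>"
      by simp
    then show ?thesis
      by (metis Ints_of_int of_nat_Suc add.commute)
  qed
  define f where "f i = of_int \<lceil>b i\<rceil> - b i" for i
  have f_nonneg: "0 \<le> f i" for i
    by (simp add: f_def)
  have f_Ints: "(real k + 1) * f i \<in> \<int>" if "i \<noteq> r" for i
    using kb [OF that] by (simp add: f_def right_diff_distrib)
  \<comment> \<open>As (k + 1) \<open>b i\<close> is integral, layer k + 2 has the fractional parts
    of layer 1, so its coordinates fall short of 1 / \<open>t i\<close> by
    \<open>f i / real (t i)\<close>. The total shortfall is at most (k + 2) / h - 1 / N = 1 /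
    h.\<close>
  have f_sum: "(\<Sum>i\<in>-{r}. f i / real (t i)) \<le> 1 / h"
  proof -
    have "q (k + 2) $ i = (1 - f i) / real (t i)" if i: "i \<noteq> r" for i
    proof -
      obtain z where z: "(real k + 1) * b i = of_int z"
        using kb [OF i] by (auto elim: Ints_cases)
      have "real (k + 2) * b i = b i + of_int z"
        using z by (simp add: algebra_simps)
      then show ?thesis
        unfolding q_nth [OF i] by (simp add: f_def)
    qed
    then have "(\<Sum>i\<in>-{r}. q (k + 2) $ i) = (\<Sum>i\<in>-{r}. 1 / real (t i) - f i / real (t i))"
      by (intro sum.cong) (auto simp: diff_divide_distrib)
    also have "\<dots> = 1 - 1 / N - (\<Sum>i\<in>-{r}. f i / real (t i))"
      by (simp add: sum_subtractf sum_unit_fractions)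
    finally have "(\<Sum>i\<in>-{r}. f i / real (t i)) \<le> real (k + 2) / h - 1 / N"
      using high [of "k + 2"] by simp
    also have "real (k + 2) / h - 1 / N = 1 / h"
    proof -
      have "real (k + 2) / h = (real k + 1) / h + 1 / h"
        by (simp flip: add_divide_distrib)
      also have "(real k + 1) / h = 1 / N"
        unfolding h(2) by simp
      finally show ?thesis
        by simp
    qed
    finally show ?thesis .
  qed
  have f_le: "f i / real (t i) \<le> 1 / h" if "i \<noteq> r" for i
  proof -
    have "f i / real (t i) \<le> (\<Sum>i\<in>-{r}. f i / real (t i))"
      using that f_nonneg by (intro member_le_sum) auto
    then show ?thesis
      using f_sum by simp
  qed
  have shifted: "u - (\<Sum>i\<in>-{r}. of_int \<lceil>b i\<rceil> *\<^sub>R frame_vec r t i) \<in> lattice_coords V" (is "?x \<in> _")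
    using u by (intro lattice_coords_simps frame_comb_in_lattice) auto
  have x_nth: "?x $ i = - f i / real (t i)" if "i \<noteq> r" for i
    unfolding vector_minus_component frame_comb_nth [OF that]
    by (simp add: f_def b_def field_simps)
  have x_sum: "(\<Sum>i\<in>UNIV. ?x $ i) = - 1 / h"
    unfolding vector_minus_component sum_subtractf sum_frame_comb using sum_u by simp
  \<comment> \<open>If the off-root part of the shifted vector is concentrated in one index i, the
    coordinate sum -1 / h determines the vector. Taking i = r covers the case that all
    \<open>f j\<close> off r vanish.\<close>
  have x_eq: "(1 / h) *\<^sub>R axis i 1 \<in> lattice_coords V"
    if fj: "\<And>j. j \<noteq> r \<Longrightarrow> f j / real (t j) = (if j = i then 1 / h else 0)" for i
  proof -
    have "?x = - ((1 / h) *\<^sub>R axis i 1)"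
    proof (rule vec_eq_by_sum)
      show "?x $ j = (- ((1 / h) *\<^sub>R axis i 1)) $ j" if "j \<noteq> r" for j
        unfolding x_nth [OF that] using fj [OF that] by (simp add: axis_def)
      show "(\<Sum>j\<in>UNIV. ?x $ j) = (\<Sum>j\<in>UNIV. (- ((1 / h) *\<^sub>R axis i 1)) $ j)"
        unfolding x_sum by (simp add: axis_def sum_negf flip: sum_divide_distrib)
    qed
    then show ?thesis
      using shifted lattice_coords_simps(4) [of ?x V] by simp
  qed
  show ?thesis
  proof (cases "\<forall>i. i \<noteq> r \<longrightarrow> f i = 0")
    case True
    then show ?thesis
      using x_eq [of r] by auto
  next
    case False
    then obtain i where i: "i \<noteq> r" "f i \<noteq> 0"
      by blast
    \<comment> \<open>As (k + 1) \<open>f i\<close> is a positive integer, \<open>f i\<close> is at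
      least 1 / (k + 1), and \<open>f_le\<close> gives N \<le> \<open>t i\<close>. But N is a
      product of factors at least 2, one of which is \<open>t i\<close>, so r and i are the only
      indices.\<close>
    obtain z where z: "(real k + 1) * f i = of_int z"
      using f_Ints [OF i(1)] by (auto elim: Ints_cases)
    have "(real k + 1) * f i > 0"
      using f_nonneg [of i] i(2) by (simp add: less_le)
    then have f1: "1 \<le> (real k + 1) * f i"
      unfolding z by simp
    have le: "(real k + 1) * f i * N \<le> real (t i)"
      using f_le [OF i(1)] h by (simp add: h(2) field_simps)
    define M where "M = (\<Prod>j\<in>-{r} - {i}. real (t j))"
    have NM: "N = real (t i) * M"
      unfolding N_eq M_def using i by (simp add: prod.remove [of "-{r}" i])
    have M1: "M \<ge> 1"
      unfolding M_def using t_ge_2 by (intro prod_ge_1) (metis of_nat_1 of_nat_le_iff one_le_numeral order_trans)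
    have "N \<le> (real k + 1) * f i * N"
      using f1 N_pos by simp
    then have "N \<le> real (t i)"
      using le by simp
    then have "M = 1"
      using M1 by (simp add: NM)
    then have N: "N = real (t i)"
      by (simp add: NM)
    have "j = i" if "j \<noteq> r" for j
    proof (rule ccontr)
      assume "j \<noteq> i"
      then have "M = real (t j) * (\<Prod>j\<in>-{r} - {i} - {j}. real (t j))"
        unfolding M_def using that by (intro prod.remove) auto
      moreover have "(\<Prod>j\<in>-{r} - {i} - {j}. real (t j)) \<ge> 1"
        using t_ge_2 by (intro prod_ge_1) (metis of_nat_1 of_nat_le_iff one_le_numeral order_trans)
      ultimately have "real (t j) \<le> 1"
        using \<open>M = 1\<close> by (metis mult_left_mono mult.right_neutral of_nat_0_le_iff)
      then show False
        using t_ge_2 [of j] by simp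
    qed
    then have UNIV: "UNIV = {r, i}"
      by blast
    have "(real k + 1) * f i = 1"
      using le f1 N_pos by (simp add: N)
    then have "f i = 1 / (real k + 1)"
      by (simp add: eq_divide_eq mult.commute)
    then have "f i / real (t i) = 1 / h"
      by (simp add: h(2) N)
    then have "(1 / h) *\<^sub>R axis i 1 \<in> lattice_coords V"
      using UNIV by (intro x_eq) auto
    then show ?thesis
      using i UNIV N by blast
  qed
qed

end

section \<open>Simplices in edge coordinates\<close>

definition edge_matrix :: "real ^ 'n \<Rightarrow> ('n::finite \<Rightarrow> real ^ 'n) \<Rightarrow> real ^ 'n ^ 'n" where
  "edge_matrix a v = (\<chi> i j. (v j - a) $ i)"

lemma edge_matrix_mult: "edge_matrix a v *v x = (\<Sum>j\<in>UNIV. x $ j *\<^sub>R (v j - a))"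
  by (simp add: vec_eq_iff edge_matrix_def matrix_vector_mult_def mult.commute)

lemma edge_matrix_mult_axis [simp]: "edge_matrix a v *v axis j 1 = v j - a"
  by (simp add: matrix_vector_mult_basis column_def edge_matrix_def vec_eq_iff)

lemma edge_matrix_mult_barycentric:
  "a + edge_matrix a v *v x = (1 - (\<Sum>j\<in>UNIV. x $ j)) *\<^sub>R a + (\<Sum>j\<in>UNIV. x $ j *\<^sub>R v j)"
  by (simp add: edge_matrix_mult algebra_simps sum_subtractf flip: scaleR_sum_left)

lemma inj_matrix_vector_mult_det:
  fixes A :: "real ^ 'n ^ 'n"
  assumes "det A \<noteq> 0"
  shows "inj ((*v) A)"
  using assms by (metis invertible_det_nz invertible_def inj_matrix_vector_mult)

lemma edge_matrix_vertices:
  assumes "det (edge_matrix a v) \<noteq> 0"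
  shows "inj v" "a \<notin> range v"
proof -
  note inj = inj_matrix_vector_mult_det [OF assms]
  show "inj v"
  proof (rule injI)
    fix i j assume "v i = v j"
    then have "edge_matrix a v *v axis i 1 = edge_matrix a v *v axis j 1"
      by simp
    then have "axis i 1 = (axis j 1 :: real ^ 'a)"
      by (rule injD [OF inj])
    then show "i = j"
      by (simp add: axis_eq_axis)
  qed
  have "v i \<noteq> a" for i
  proof
    assume "v i = a"
    then have "edge_matrix a v *v axis i 1 = edge_matrix a v *v 0"
      by simp
    then have "axis i 1 = (0 :: real ^ 'a)"
      by (rule injD [OF inj])
    then show False
      by (simp add: axis_eq_0_iff)
  qed
  then show "a \<notin> range v"
    by auto
qed

text \<open>A kernel vector x of the edge matrix amounts to an affine dependence with weight
  \<open>x $ j\<close> at \<open>v j\<close> and minus the coordinate sum at a.\<close>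

lemma affine_independent_iff_det:
  assumes v: "inj v" "a \<notin> range v"
  shows "\<not> affine_dependent (insert a (range v)) \<longleftrightarrow> det (edge_matrix a v) \<noteq> 0"
proof
  have sums: "(\<Sum>x\<in>insert a (range v). f x) = f a + (\<Sum>j\<in>UNIV. f (v j))" for f :: "real ^ 'a \<Rightarrow> 'b::comm_monoid_add"
    using v by (simp add: sum.reindex)
  show "det (edge_matrix a v) \<noteq> 0" if "\<not> affine_dependent (insert a (range v))"
  proof
    assume "det (edge_matrix a v) = 0"
    then have "\<not> inj ((*v) (edge_matrix a v))"
      using det_nz_iff_inj [OF matrix_vector_mul_linear] by (metis matrix_of_matrix_vector_mul)
    then obtain x where x: "x \<noteq> 0" "edge_matrix a v *v x = 0"
      by (metis linear_injective_0 matrix_vector_mul_linear)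
    define U where "U y = (if y = a then - (\<Sum>j\<in>UNIV. x $ j) else x $ inv v y)" for y
    have U: "U a = - (\<Sum>j\<in>UNIV. x $ j)" "U (v j) = x $ j" for j
      using v by (auto simp: U_def inv_f_f)
    obtain j where "x $ j \<noteq> 0"
      using x by (auto simp: vec_eq_iff)
    then have "\<exists>y\<in>insert a (range v). U y \<noteq> 0"
      by (intro bexI [of _ "v j"]) (auto simp: U)
    moreover have "sum U (insert a (range v)) = 0"
      by (simp add: sums U)
    moreover have "(\<Sum>y\<in>insert a (range v). U y *\<^sub>R y) = 0"
      using x(2) unfolding sums U edge_matrix_mult
      by (simp add: algebra_simps sum_subtractf flip: scaleR_sum_left)
    ultimately have "affine_dependent (insert a (range v))"
      by (subst affine_dependent_explicit_finite) auto
    then show False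
      using that by simp
  qed
  show "\<not> affine_dependent (insert a (range v))" if d: "det (edge_matrix a v) \<noteq> 0"
  proof
    assume "affine_dependent (insert a (range v))"
    then obtain U where U: "sum U (insert a (range v)) = 0" "\<exists>y\<in>insert a (range v). U y \<noteq> 0"
      "(\<Sum>y\<in>insert a (range v). U y *\<^sub>R y) = 0"
      by (subst (asm) affine_dependent_explicit_finite) auto
    define x where "x = (\<chi> j. U (v j))"
    have Ua: "U a = - (\<Sum>j\<in>UNIV. x $ j)"
      using U(1) unfolding sums by (simp add: x_def)
    have "edge_matrix a v *v x = 0"
      using U(3) unfolding sums edge_matrix_mult Ua
      by (simp add: x_def algebra_simps sum_subtractf flip: scaleR_sum_left)
    then have "x = 0"
      using injD [OF inj_matrix_vector_mult_det [OF d], of x 0] by simp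
    then have "U (v j) = 0" for j
      by (simp add: x_def vec_eq_iff)
    then show False
      using U(2) Ua \<open>x = 0\<close> by auto
  qed
qed

lemma interior_simplex:
  fixes a :: "real ^ 'n"
  assumes d: "det (edge_matrix a v) \<noteq> 0"
  shows "interior (convex hull (insert a (range v))) =
    {a + edge_matrix a v *v x | x. (\<forall>i. 0 < x $ i) \<and> (\<Sum>i\<in>UNIV. x $ i) < 1}"
proof -
  note v = edge_matrix_vertices [OF d]
  have ind: "\<not> affine_dependent (insert a (range v))"
    using affine_independent_iff_det v d by blast
  have sums: "(\<Sum>x\<in>insert a (range v). f x) = f a + (\<Sum>j\<in>UNIV. f (v j))" for f :: "real ^ 'n \<Rightarrow> 'b::comm_monoid_add"
    using v by (simp add: sum.reindex)
  have card: "card (insert a (range v)) = Suc CARD('n)"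
    using v by (simp add: card_image)
  have "interior (convex hull (insert a (range v))) =
    {y. \<exists>u. (\<forall>x\<in>insert a (range v). 0 < u x) \<and> sum u (insert a (range v)) = 1 \<and>
       (\<Sum>x\<in>insert a (range v). u x *\<^sub>R x) = y}"
    using interior_convex_hull_explicit_minimal [OF ind] card by simp
  also have "\<dots> = {a + edge_matrix a v *v x | x. (\<forall>i. 0 < x $ i) \<and> (\<Sum>i\<in>UNIV. x $ i) < 1}"
  proof (intro equalityI subsetI)
    fix y assume "y \<in> {y. \<exists>u. (\<forall>x\<in>insert a (range v). 0 < u x) \<and> sum u (insert a (range v)) = 1 \<and>
       (\<Sum>x\<in>insert a (range v). u x *\<^sub>R x) = y}"
    then obtain u where u: "\<forall>x\<in>insert a (range v). 0 < u x" "sum u (insert a (range v)) = 1"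
        "(\<Sum>x\<in>insert a (range v). u x *\<^sub>R x) = y"
      by blast
    have ua: "u a = 1 - (\<Sum>j\<in>UNIV. u (v j))"
      using u(2) unfolding sums by simp
    have "y = a + edge_matrix a v *v (\<chi> i. u (v i))"
      using u(3) unfolding sums edge_matrix_mult_barycentric ua by simp
    moreover have "0 < u a" "\<forall>i. 0 < (\<chi> i. u (v i)) $ i"
      using u(1) by auto
    ultimately show "y \<in> {a + edge_matrix a v *v x | x. (\<forall>i. 0 < x $ i) \<and> (\<Sum>i\<in>UNIV. x $ i) < 1}"
      using ua by (intro CollectI exI [of _ "\<chi> i. u (v i)"]) simp
  next
    fix y assume "y \<in> {a + edge_matrix a v *v x | x. (\<forall>i. 0 < x $ i) \<and> (\<Sum>i\<in>UNIV. x $ i) < 1}"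
    then obtain x where x: "\<forall>i. 0 < x $ i" "(\<Sum>i\<in>UNIV. x $ i) < 1" "y = a + edge_matrix a v *v x"
      by blast
    define u where "u y = (if y = a then 1 - (\<Sum>j\<in>UNIV. x $ j) else x $ inv v y)" for y
    have u: "u a = 1 - (\<Sum>j\<in>UNIV. x $ j)" "u (v j) = x $ j" for j
      using v by (auto simp: u_def inv_f_f)
    show "y \<in> {y. \<exists>u. (\<forall>x\<in>insert a (range v). 0 < u x) \<and> sum u (insert a (range v)) = 1 \<and>
       (\<Sum>x\<in>insert a (range v). u x *\<^sub>R x) = y}"
      using x by (intro CollectI exI [of _ u]) (simp add: sums u edge_matrix_mult_barycentric)
  qed
  finally show ?thesis .
qed

lemma rel_interior_facet:
  fixes a :: "real ^ 'n"
  assumes d: "det (edge_matrix a v) \<noteq> 0"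
  shows "rel_interior (convex hull (range v)) =
    {a + edge_matrix a v *v x | x. (\<forall>i. 0 < x $ i) \<and> (\<Sum>i\<in>UNIV. x $ i) = 1}"
proof -
  note v = edge_matrix_vertices [OF d]
  have "\<not> affine_dependent (insert a (range v))"
    using affine_independent_iff_det v d by blast
  then have ind: "\<not> affine_dependent (range v)"
    by (rule affine_independent_subset) auto
  have sums: "(\<Sum>x\<in>range v. f x) = (\<Sum>j\<in>UNIV. f (v j))" for f :: "real ^ 'n \<Rightarrow> 'b::comm_monoid_add"
    using v by (simp add: sum.reindex)
  have "rel_interior (convex hull (range v)) =
    {y. \<exists>u. (\<forall>x\<in>range v. 0 < u x) \<and> sum u (range v) = 1 \<and> (\<Sum>x\<in>range v. u x *\<^sub>R x) = y}"
    by (rule rel_interior_convex_hull_explicit [OF ind])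
  also have "\<dots> = {a + edge_matrix a v *v x | x. (\<forall>i. 0 < x $ i) \<and> (\<Sum>i\<in>UNIV. x $ i) = 1}"
  proof (intro equalityI subsetI)
    fix y assume "y \<in> {y. \<exists>u. (\<forall>x\<in>range v. 0 < u x) \<and> sum u (range v) = 1 \<and> (\<Sum>x\<in>range v. u x *\<^sub>R x) = y}"
    then obtain u where "\<forall>x\<in>range v. 0 < u x" "sum u (range v) = 1" "(\<Sum>x\<in>range v. u x *\<^sub>R x) = y"
      by blast
    then show "y \<in> {a + edge_matrix a v *v x | x. (\<forall>i. 0 < x $ i) \<and> (\<Sum>i\<in>UNIV. x $ i) = 1}"
      by (intro CollectI exI [of _ "\<chi> i. u (v i)"]) (simp add: sums edge_matrix_mult_barycentric)
  next
    fix y assume "y \<in> {a + edge_matrix a v *v x | x. (\<forall>i. 0 < x $ i) \<and> (\<Sum>i\<in>UNIV. x $ i) = 1}"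
    then obtain x where "\<forall>i. 0 < x $ i" "(\<Sum>i\<in>UNIV. x $ i) = 1" "y = a + edge_matrix a v *v x"
      by blast
    then show "y \<in> {y. \<exists>u. (\<forall>x\<in>range v. 0 < u x) \<and> sum u (range v) = 1 \<and> (\<Sum>x\<in>range v. u x *\<^sub>R x) = y}"
      using v(1) by (intro CollectI exI [of _ "\<lambda>y. x $ inv v y"]) (simp add: sums edge_matrix_mult_barycentric)
  qed
  finally show ?thesis .
qed

text \<open>The simplex is a translate of the image of the standard simplex under the edge
  matrix.\<close>

lemma measure_simplex:
  fixes a :: "real ^ 'n"
  shows "measure lebesgue (convex hull (insert a (range v))) = \<bar>det (edge_matrix a v)\<bar> / fact CARD('n)"
proof -
  define std :: "(real ^ 'n) set" where "std = convex hull (insert 0 Basis)"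
  have lin: "linear ((*v) (edge_matrix a v))"
    by (rule matrix_vector_mul_linear)
  have "compact std"
    unfolding std_def by (intro finite_imp_compact_convex_hull) auto
  then have std: "std \<in> lmeasurable" "measure lebesgue std = 1 / fact CARD('n)"
    using content_std_simplex [where 'a = "real ^ 'n"]
    by (auto simp: std_def lmeasurable_compact dest: compact_imp_closed)
  have "range v = (\<lambda>x. a + edge_matrix a v *v x) ` Basis"
    by (force simp: Basis_vec_def image_iff)
  then have "insert a (range v) = (+) a ` (*v) (edge_matrix a v) ` insert 0 Basis"
    by (simp add: image_image)
  then have "convex hull (insert a (range v)) = (+) a ` (*v) (edge_matrix a v) ` std"
    unfolding std_def by (simp only: convex_hull_translation convex_hull_linear_image [OF lin])
  then have "measure lebesgue (convex hull (insert a (range v))) = measure lebesgue ((*v) (edge_matrix a v) ` std)"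
    by (simp only: measure_translation)
  also have "\<dots> = \<bar>det (edge_matrix a v)\<bar> / fact CARD('n)"
    using measure_linear_image_cart [OF lin std(1)] std(2) by simp
  finally show ?thesis .
qed

lemma card_translated_lattice_coords:
  fixes a :: "real ^ 'n"
  assumes V: "det V \<noteq> 0" and a: "a \<in> int_lattice"
  shows "card ({a + V *v x | x. P x} \<inter> int_lattice) = card {x \<in> lattice_coords V. P x}"
proof -
  have "{a + V *v x | x. P x} \<inter> int_lattice = (\<lambda>x. a + V *v x) ` {x \<in> lattice_coords V. P x}"
  proof -
    have "a + V *v x \<in> int_lattice \<longleftrightarrow> V *v x \<in> int_lattice" for x
    proof
      assume "a + V *v x \<in> int_lattice"
      then have "a + V *v x - a \<in> int_lattice"
        using a by (rule int_lattice_simps)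
      then show "V *v x \<in> int_lattice"
        by simp
    qed (use a in simp)
    then show ?thesis
      by (auto simp: lattice_coords_def)
  qed
  moreover have "inj (\<lambda>x. a + V *v x)"
    using inj_matrix_vector_mult_det [OF V] by (auto simp: inj_def)
  ultimately show ?thesis
    by (simp add: card_image inj_on_subset)
qed

text \<open>A facet of a simplex is spanned by all vertices but one. The omitted vertex becomes the
  apex a, the others are labelled arbitrarily by the index type, and lattice points are counted in
  edge coordinates.\<close>

lemma simplices_int_facet_iff:
  fixes S :: "(real ^ 'n) set"
  shows "S \<in> simplices_int_facet k l \<longleftrightarrow>
    (\<exists>a v. det (edge_matrix a v) \<noteq> 0 \<and> a \<in> int_lattice \<and> range v \<subseteq> int_lattice \<and>
      S = convex hull (insert a (range v)) \<and>
      card (interior_coords (edge_matrix a v)) = k \<and> card (facet_coords (edge_matrix a v)) = l)"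
    (is "_ \<longleftrightarrow> (\<exists>a v. ?P a v)")
proof -
  have cards: "card (interior (convex hull (insert a (range v))) \<inter> int_lattice) = card (interior_coords (edge_matrix a v))"
      "card (rel_interior (convex hull (range v)) \<inter> int_lattice) = card (facet_coords (edge_matrix a v))"
    if "det (edge_matrix a v) \<noteq> 0" "a \<in> int_lattice" for a :: "real ^ 'n" and v
    unfolding interior_simplex [OF that(1)] rel_interior_facet [OF that(1)]
      interior_coords_def facet_coords_def
    using that by (simp_all add: card_translated_lattice_coords)
  show ?thesis
  proof
    assume "S \<in> simplices_int_facet k l"
    then obtain F where S: "int CARD('n) simplex S" "lattice_polytope S" "card (interior S \<inter> int_lattice) = k"
      and F: "F facet_of S" "card (rel_interior F \<inter> int_lattice) = l"
      unfolding simplices_int_facet_def simplices_int_def by blast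
    obtain C where C: "\<not> affine_dependent C" "card C = Suc CARD('n)" "S = convex hull C"
      using S(1) unfolding simplex_def by auto
    have "C \<subseteq> int_lattice"
      using S(2) C extreme_point_of_convex_hull_affine_independent [OF C(1)]
      by (auto simp: lattice_polytope_def)
    obtain a where a: "a \<in> C" "F = convex hull (C - {a})"
      using F(1) C facet_of_convex_hull_affine_independent by blast
    have "finite C"
      using C(1) aff_independent_finite by blast
    then have "card (C - {a}) = CARD('n)"
      using C(2) a by simp
    then obtain v :: "'n \<Rightarrow> real ^ 'n" where v: "bij_betw v UNIV (C - {a})"
      using \<open>finite C\<close> finite_same_card_bij [of "UNIV :: 'n set" "C - {a}"] by auto
    then have ran: "range v = C - {a}" "inj v" "a \<notin> range v"
      by (auto simp: bij_betw_def)
    then have ins: "insert a (range v) = C"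
      using a by auto
    then have d: "det (edge_matrix a v) \<noteq> 0"
      using affine_independent_iff_det ran C(1) by metis
    have "?P a v"
      using d a \<open>C \<subseteq> int_lattice\<close> ran(1) C(3) ins S(3) F(2) cards [OF d] by auto
    then show "\<exists>a v. ?P a v"
      by blast
  next
    assume "\<exists>a v. ?P a v"
    then obtain a v where P: "?P a v"
      by blast
    then have d: "det (edge_matrix a v) \<noteq> 0"
      by simp
    note v = edge_matrix_vertices [OF d]
    have ind: "\<not> affine_dependent (insert a (range v))"
      using affine_independent_iff_det v d by blast
    have "card (insert a (range v)) = Suc CARD('n)"
      using v by (simp add: card_image)
    then have "int CARD('n) simplex S"
      using P ind unfolding simplex_def by (intro exI [of _ "insert a (range v)"]) auto
    moreover have "lattice_polytope S"
      using P extreme_point_of_convex_hull_affine_independent [OF ind]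
      by (auto simp: lattice_polytope_def intro!: polytope_convex_hull)
    moreover have "convex hull (range v) facet_of S"
    proof -
      have "insert a (range v) - {a} = range v"
        using v by auto
      moreover have "S = convex hull (insert a (range v))"
        using P by blast
      ultimately show ?thesis
        by (simp add: facet_of_convex_hull_affine_independent [OF ind]) (intro exI [of _ a], simp)
    qed
    ultimately show "S \<in> simplices_int_facet k l"
      using P cards [OF d] unfolding simplices_int_facet_def simplices_int_def by blast
  qed
qed

lemma unimodular_matrix_image_int_lattice:
  fixes M :: "real ^ 'n ^ 'n"
  assumes M: "\<And>i j. M $ i $ j \<in> \<int>" and d: "\<bar>det M\<bar> = 1"
  shows "(*v) M ` int_lattice = int_lattice"
proof (intro equalityI subsetI)
  fix x assume "x \<in> (*v) M ` int_lattice"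
  then show "x \<in> int_lattice"
    using int_matrix_mult_int_lattice [of M] M by blast
next
  fix x :: "real ^ 'n" assume x: "x \<in> int_lattice"
  define y where "y = (\<chi> k. det (\<chi> i j. if j = k then x $ i else M $ i $ j) / det M)"
  have "M *v y = x"
    using cramer [of M y x] d by (auto simp: y_def)
  moreover have "y $ k \<in> \<int>" for k
  proof -
    have "det (\<chi> i j. if j = k then x $ i else M $ i $ j) \<in> \<int>"
      using x M by (intro det_Ints) (auto simp: int_lattice_def)
    moreover have "det M = 1 \<or> det M = - 1"
      using d by linarith
    ultimately show ?thesis
      by (auto simp: y_def)
  qed
  ultimately show "x \<in> (*v) M ` int_lattice"
    by (auto simp: int_lattice_def)
qed

section \<open>The extremal simplex\<close>

text \<open>The index in the last position serves as the root r: the weights of the others multiply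
  to s_d - 1 by the Sylvester recursion.\<close>

definition weight :: "(nat \<Rightarrow> 'n::finite) \<Rightarrow> 'n \<Rightarrow> nat" where
  "weight c i = sylvester (inv_into {1..CARD('n)} c i)"

context
  fixes c :: "nat \<Rightarrow> 'n::finite"
  assumes c: "bij_betw c {1..CARD('n)} UNIV"
begin

lemma weight_enum: "i \<in> {1..CARD('n)} \<Longrightarrow> weight c (c i) = sylvester i"
  using c by (simp add: weight_def bij_betw_def inv_into_f_f)

lemma bij_betw_nonroot: "bij_betw c {1..<CARD('n)} (- {c CARD('n)})"
proof -
  have "{1..CARD('n)} - {CARD('n)} = {1..<CARD('n)}"
    by auto
  then show ?thesis
    using bij_betw_DiffI [OF c, of "{CARD('n)}" "{c CARD('n)}"] c
    by (auto simp: Compl_eq_Diff_UNIV bij_betw_def Suc_le_eq)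
qed

lemma prod_weight: "(\<Prod>i\<in>- {c CARD('n)}. real (weight c i)) = real (sylvester CARD('n)) - 1"
proof -
  have "(\<Prod>i\<in>- {c CARD('n)}. real (weight c i)) = (\<Prod>i\<in>{1..<CARD('n)}. real (weight c (c i)))"
    by (rule prod.reindex_bij_betw [OF bij_betw_nonroot, symmetric])
  also have "\<dots> = (\<Prod>i\<in>{1..<CARD('n)}. real (sylvester i))"
    by (intro prod.cong) (auto simp: weight_enum)
  finally show ?thesis
    by (subst sylvester.simps) simp
qed

lemma weight_ge_2: "2 \<le> weight c i"
  by (simp add: weight_def sylvester_ge_2)

lemma sum_weight: "(\<Sum>i\<in>- {c CARD('n)}. 1 / real (weight c i)) = 1 - 1 / (real (sylvester CARD('n)) - 1)"
proof -
  have "(\<Sum>i\<in>- {c CARD('n)}. 1 / real (weight c i)) = (\<Sum>i\<in>{1..<CARD('n)}. 1 / real (weight c (c i)))"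
    by (rule sum.reindex_bij_betw [OF bij_betw_nonroot, symmetric])
  also have "\<dots> = (\<Sum>i=1..CARD('n) - 1. 1 / real (sylvester i))"
    by (intro sum.cong) (auto simp: weight_enum)
  also have "\<dots> = 1 - 1 / (\<Prod>i=1..CARD('n) - 1. real (sylvester i))"
    by (rule sum_inverse_sylvester)
  also have "(\<Prod>i=1..CARD('n) - 1. real (sylvester i)) = real (sylvester CARD('n)) - 1"
    using sylvester_Suc [of "CARD('n) - 1"] by (simp add: Suc_le_eq)
  finally show ?thesis .
qed

end

text \<open>Combine |det V| / N^2 \<le> |det V| \<Prod> \<beta> with |det V| \<Prod> \<beta> \<le> k
  + 1. Equality of the ends gives \<Prod> \<beta> = 1 / N^2, so \<beta> has the Sylvester
  coordinates and \<open>extremal_apex\<close> applies.\<close>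

lemma (in unique_facet_point) det_le:
  defines "N \<equiv> real (sylvester CARD('n)) - 1"
  shows "\<bar>det V\<bar> \<le> (real (card (interior_coords V)) + 1) * N\<^sup>2"
    and "\<bar>det V\<bar> = (real (card (interior_coords V)) + 1) * N\<^sup>2 \<Longrightarrow> CARD('n) \<ge> 2 \<Longrightarrow>
      \<exists>c. bij_betw c {1..CARD('n)} UNIV \<and>
        (\<forall>i. i \<noteq> c CARD('n) \<longrightarrow> frame_vec (c CARD('n)) (weight c) i \<in> lattice_coords V) \<and>
        (1 / ((real (card (interior_coords V)) + 1) * N)) *\<^sub>R axis (c CARD('n)) 1 \<in> lattice_coords V"
proof -
  define k where "k = real (card (interior_coords V))"
  obtain c where c: "bij_betw c {1..CARD('n)} UNIV" "1 / N\<^sup>2 \<le> (\<Prod>i\<in>UNIV. \<beta> $ i)"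
    and eq: "1 / N\<^sup>2 = (\<Prod>i\<in>UNIV. \<beta> $ i) \<Longrightarrow>
       (\<forall>i\<in>{1..<CARD('n)}. \<beta> $ c i = 1 / sylvester i) \<and> \<beta> $ c CARD('n) = 1 / N"
    unfolding N_def by (rule prod_beta_ge) blast
  let ?r = "c CARD('n)"
  have N: "N = (\<Prod>i\<in>- {?r}. real (weight c i))"
    unfolding N_def by (rule prod_weight [OF c(1), symmetric])
  have "N > 0"
    unfolding N using weight_ge_2 [OF c(1)] by (intro prod_pos) (metis of_nat_0_less_iff less_le_trans pos2)
  have "\<bar>det V\<bar> * (1 / N\<^sup>2) \<le> \<bar>det V\<bar> * (\<Prod>i\<in>UNIV. \<beta> $ i)"
    using c(2) by (intro mult_left_mono) auto
  also have "\<dots> \<le> k + 1"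
    using det_mult_prod_le by (simp add: k_def)
  finally show "\<bar>det V\<bar> \<le> (real (card (interior_coords V)) + 1) * N\<^sup>2"
    using \<open>N > 0\<close> by (simp add: k_def pos_divide_le_eq)
  assume det: "\<bar>det V\<bar> = (real (card (interior_coords V)) + 1) * N\<^sup>2" and dim: "CARD('n) \<ge> 2"
  have "(k + 1) * (N\<^sup>2 * (\<Prod>i\<in>UNIV. \<beta> $ i)) \<le> (k + 1) * 1"
    using det_mult_prod_le unfolding det by (simp add: k_def mult.assoc)
  then have "N\<^sup>2 * (\<Prod>i\<in>UNIV. \<beta> $ i) \<le> 1"
    by (rule mult_left_le_imp_le) (simp add: k_def add_pos_nonneg add.commute)
  then have "(\<Prod>i\<in>UNIV. \<beta> $ i) \<le> 1 / N\<^sup>2"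
    using \<open>N > 0\<close> by (simp add: field_simps)
  then have beta_eq: "\<And>i. i \<in> {1..<CARD('n)} \<Longrightarrow> \<beta> $ c i = 1 / sylvester i" "\<beta> $ ?r = 1 / N"
    using eq c(2) by auto
  interpret unit_fraction_point V \<beta> ?r "weight c" N
  proof
    show "\<beta> $ i = 1 / real (weight c i)" if "i \<noteq> ?r" for i
    proof -
      have "i \<in> c ` {1..<CARD('n)}"
        using bij_betw_nonroot [OF c(1)] that by (auto simp: bij_betw_def)
      then show ?thesis
        using beta_eq(1) weight_enum [OF c(1)] by auto
    qed
  qed (use weight_ge_2 [OF c(1)] N beta_eq in auto)
  let ?h = "(real (card (interior_coords V)) + 1) * N"
  consider "(1 / ?h) *\<^sub>R axis ?r 1 \<in> lattice_coords V"
    | i where "i \<noteq> ?r" "UNIV = {?r, i}" "(1 / ?h) *\<^sub>R axis i 1 \<in> lattice_coords V"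
    using extremal_apex [OF det] by blast
  then show "\<exists>c. bij_betw c {1..CARD('n)} UNIV \<and>
        (\<forall>i. i \<noteq> c CARD('n) \<longrightarrow> frame_vec (c CARD('n)) (weight c) i \<in> lattice_coords V) \<and>
        (1 / ?h) *\<^sub>R axis (c CARD('n)) 1 \<in> lattice_coords V"
  proof cases
    case 1
    then show ?thesis
      using c(1) frame_vec_in_lattice by blast
  next
    case (2 i)
    have "CARD('n) = card {?r, i}"
      using 2(2) by simp
    then have card: "CARD('n) = 2"
      using 2(1) by simp
    \<comment> \<open>In dimension 2 the enumeration is reversed. Either order attaches s_1 to the
      vertex that is not the root, so the new frame vector is the negative of the old one.\<close>
    define c' where "c' j = (if j = 1 then ?r else i)" for j :: nat
    have c': "bij_betw c' {1..CARD('n)} UNIV"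
      unfolding bij_betw_def
    proof
      show "inj_on c' {1..CARD('n)}"
        using 2(1) by (auto simp: card inj_on_def c'_def)
      have "{1..CARD('n)} = {1, 2}"
        by (auto simp: card)
      then show "c' ` {1..CARD('n)} = UNIV"
        using 2(2) by (auto simp: c'_def)
    qed
    have "i = c 1"
    proof -
      have "i \<in> c ` {1..<CARD('n)}"
        using bij_betw_nonroot [OF c(1)] 2(1) by (auto simp: bij_betw_def)
      then obtain j where j: "j \<in> {1..<CARD('n)}" "i = c j"
        by blast
      then have "j = 1"
        using card by simp
      then show ?thesis
        using j by simp
    qed
    then have w: "weight c' ?r = weight c i"
      using weight_enum [OF c', of 1] weight_enum [OF c(1), of 1] by (simp add: card c'_def)
    have root: "c' CARD('n) = i"
      by (simp add: card c'_def)
    have "frame_vec i (weight c') ?r = - frame_vec ?r (weight c) i"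
      by (simp add: frame_vec_def w scaleR_right_diff_distrib)
    then have "frame_vec i (weight c') ?r \<in> lattice_coords V"
      using frame_vec_in_lattice [OF 2(1)] by (metis lattice_coords_simps(4))
    moreover have "j = ?r" if "j \<noteq> i" for j
      using 2(2) that by blast
    ultimately show ?thesis
      using 2(3) c' by (intro exI [of _ c']) (auto simp: root)
  qed
qed

text \<open>The chosen facet lies in the hyperplane where the last coordinate vanishes: its apex is
  the vertex on the last axis, and the origin is the facet vertex labelled by the root
  index.\<close>

definition ref_apex :: "(nat \<Rightarrow> 'n::finite) \<Rightarrow> nat \<Rightarrow> real ^ 'n" where
  "ref_apex b k = ((real k + 1) * (real (sylvester CARD('n)) - 1)) *\<^sub>R axis (b CARD('n)) 1"

definition ref_vertex :: "(nat \<Rightarrow> 'n::finite) \<Rightarrow> 'n \<Rightarrow> real ^ 'n" where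
  "ref_vertex b j = (if j = b CARD('n) then 0 else real (weight b j) *\<^sub>R axis j 1)"

lemma sylvester_simplex_eq:
  fixes b :: "nat \<Rightarrow> 'n::finite"
  assumes b: "bij_betw b {1..CARD('n)} UNIV"
  shows "sylvester_simplex b k = convex hull (insert (ref_apex b k) (range (ref_vertex b)))"
proof -
  have "range (ref_vertex b) = ref_vertex b ` insert (b CARD('n)) (b ` {1..<CARD('n)})"
    using bij_betw_nonroot [OF b] by (auto simp: bij_betw_def)
  also have "\<dots> = insert 0 ((\<lambda>i. ref_vertex b (b i)) ` {1..<CARD('n)})"
    by (simp add: image_image) (simp add: ref_vertex_def)
  also have "(\<lambda>i. ref_vertex b (b i)) ` {1..<CARD('n)} = (\<lambda>i. real (sylvester i) *\<^sub>R axis (b i) 1) ` {1..<CARD('n)}"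
  proof (intro image_cong refl)
    fix i assume i: "i \<in> {1..<CARD('n)}"
    then have "b i \<noteq> b CARD('n)"
      using bij_betw_apply [OF bij_betw_nonroot [OF b]] by blast
    then show "ref_vertex b (b i) = real (sylvester i) *\<^sub>R axis (b i) 1"
      using i weight_enum [OF b, of i] by (simp add: ref_vertex_def)
  qed
  also have "\<dots> = {real (sylvester i) *\<^sub>R axis (b i) 1 | i. 1 \<le> i \<and> i \<le> CARD('n) - 1}"
    by (auto simp: image_iff) (metis Suc_le_eq Suc_pred zero_less_card_finite le_Suc_eq less_Suc_eq_le)+
  finally show ?thesis
    unfolding sylvester_simplex_def Let_def ref_apex_def by (simp add: insert_commute Un_commute)
qed

lemma ref_matrix_mult:
  fixes b :: "nat \<Rightarrow> 'n::finite"
  shows "(edge_matrix (ref_apex b k) (ref_vertex b) *v x) $ i =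
    (if i = b CARD('n) then - ((real k + 1) * (real (sylvester CARD('n)) - 1)) * (\<Sum>j\<in>UNIV. x $ j)
     else real (weight b i) * x $ i)"
proof -
  let ?r = "b CARD('n)"
  have "edge_matrix (ref_apex b k) (ref_vertex b) *v x =
      (\<Sum>j\<in>UNIV. x $ j *\<^sub>R ref_vertex b j) - (\<Sum>j\<in>UNIV. x $ j) *\<^sub>R ref_apex b k"
    by (simp add: edge_matrix_mult scaleR_right_diff_distrib sum_subtractf scaleR_sum_left)
  moreover have "(\<Sum>j\<in>UNIV. x $ j *\<^sub>R ref_vertex b j) $ i = (\<Sum>j\<in>UNIV. if j = i then (if i = ?r then 0 else real (weight b i) * x $ i) else 0)"
    unfolding sum_component by (intro sum.cong) (auto simp: ref_vertex_def axis_def)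
  ultimately show ?thesis
    by (simp add: ref_apex_def axis_def)
qed

lemma frame_matrix_mult_axis:
  "frame_matrix r t u *v axis j 1 = (if j = r then u else frame_vec r t j)"
  by (simp add: matrix_vector_mult_basis column_def frame_matrix_def vec_eq_iff)

lemma frame_matrix_mult_nth:
  "j \<noteq> r \<Longrightarrow> (frame_matrix r t (z *\<^sub>R axis r 1) *v x) $ j = x $ j / real (t j)"
  unfolding frame_matrix_mult vector_add_component by (subst frame_comb_nth) (auto simp: axis_def)

lemma sum_frame_matrix_mult:
  "(\<Sum>j\<in>UNIV. (frame_matrix r t (z *\<^sub>R axis r 1) *v x) $ j) = x $ r * z"
  unfolding frame_matrix_mult vector_add_component sum.distrib sum_frame_comb
  by (simp add: axis_def if_distrib cong: if_cong)

section \<open>Volume and lattice points of the reference simplex\<close>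

context
  fixes b :: "nat \<Rightarrow> 'n::finite" and k :: nat and N h :: real
  assumes b: "bij_betw b {1..CARD('n)} UNIV"
  defines "N \<equiv> real (sylvester CARD('n)) - 1"
    and "h \<equiv> (real k + 1) * N"
begin

abbreviation (input) "V0 \<equiv> edge_matrix (ref_apex b k) (ref_vertex b)"
abbreviation (input) "r0 \<equiv> b CARD('n)"

lemma ref_weight_pos: "weight b i > 0"
  using weight_ge_2 [OF b, of i] by simp

lemma ref_N_pos: "N > 0" "h > 0"
proof -
  show "N > 0"
    unfolding N_def prod_weight [OF b, symmetric] using ref_weight_pos by (intro prod_pos) auto
  then show "h > 0"
    by (simp add: h_def)
qed

lemma abs_det_frame_matrix:
  "\<bar>det (frame_matrix r0 (weight b) (- (1 / h) *\<^sub>R axis r0 1))\<bar> = 1 / (h * N)"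
proof -
  have "det (frame_matrix r0 (weight b) (- (1 / h) *\<^sub>R axis r0 1)) = - 1 / (h * N)"
    using ref_weight_pos
    by (subst det_frame_matrix) (simp_all add: prod_weight [OF b] axis_def sum_negf flip: N_def sum_divide_distrib)
  then show ?thesis
    using ref_N_pos by simp
qed

text \<open>The inverse of the reference edge matrix is the frame matrix with root column -(1 / h)
  e_r.\<close>

lemma abs_det_ref: "\<bar>det V0\<bar> = h * N"
proof -
  let ?F = "frame_matrix r0 (weight b) (- (1 / h) *\<^sub>R axis r0 1)"
  have "V0 *v (?F *v x) = x" for x
  proof -
    have "(V0 *v (?F *v x)) $ i = x $ i" for i
    proof (cases "i = r0")
      case True
      then show ?thesis
        unfolding ref_matrix_mult sum_frame_matrix_mult using ref_N_pos by (simp add: h_def N_def)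
    next
      case False
      then have "(?F *v x) $ i = x $ i / real (weight b i)"
        by (rule frame_matrix_mult_nth)
      then show ?thesis
        using False ref_weight_pos [of i] unfolding ref_matrix_mult by simp
    qed
    then show ?thesis
      by (simp add: vec_eq_iff)
  qed
  then have "V0 ** ?F = mat 1"
    by (simp add: matrix_eq flip: matrix_vector_mul_assoc)
  then have "\<bar>det V0\<bar> * \<bar>det ?F\<bar> = 1"
    by (metis abs_1 abs_mult det_I det_mul)
  then show ?thesis
    unfolding abs_det_frame_matrix using ref_N_pos by (simp add: field_simps)
qed

text \<open>In the original coordinates this is the point with last coordinate m and all others 1:
  the facet point for m = 0, the interior points for m = 1, ..., k.\<close>

definition ref_point :: "nat \<Rightarrow> real ^ 'n" where
  "ref_point m = (\<chi> j. if j = r0 then 1 / N - real m / h else 1 / real (weight b j))"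

lemma sum_ref_point: "(\<Sum>j\<in>UNIV. ref_point m $ j) = 1 - real m / h"
proof -
  have "(\<Sum>j\<in>UNIV. ref_point m $ j) = 1 / N - real m / h + (\<Sum>j\<in>UNIV - {r0}. ref_point m $ j)"
    by (simp add: sum.remove [of UNIV r0] ref_point_def)
  also have "(\<Sum>j\<in>UNIV - {r0}. ref_point m $ j) = (\<Sum>j\<in>- {r0}. 1 / real (weight b j))"
    by (intro sum.cong) (auto simp: ref_point_def)
  finally show ?thesis
    using sum_weight [OF b] by (simp add: N_def)
qed

lemma lattice_coords_ref:
  "x \<in> lattice_coords V0 \<longleftrightarrow> (\<forall>j. j \<noteq> r0 \<longrightarrow> real (weight b j) * x $ j \<in> \<int>) \<and> h * (\<Sum>j\<in>UNIV. x $ j) \<in> \<int>"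
proof -
  have "x \<in> lattice_coords V0 \<longleftrightarrow> (\<forall>j. (V0 *v x) $ j \<in> \<int>)"
    by (simp add: lattice_coords_def int_lattice_def)
  also have "\<dots> \<longleftrightarrow> (\<forall>j. j \<noteq> r0 \<longrightarrow> real (weight b j) * x $ j \<in> \<int>) \<and> - h * (\<Sum>j\<in>UNIV. x $ j) \<in> \<int>"
    unfolding ref_matrix_mult by (auto simp: h_def N_def)
  finally show ?thesis
    by (metis minus_in_Ints_iff mult_minus_left)
qed

lemma h_Ints: "h \<in> \<int>"
  unfolding h_def N_def by (intro Ints_mult Ints_add Ints_diff) auto

lemma ref_point_in:
  assumes "m \<le> k"
  shows "ref_point m \<in> lattice_coords V0" "0 < ref_point m $ j"
proof -
  have "h * (1 - real m / h) = h - real m"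
    using ref_N_pos by (simp add: right_diff_distrib)
  then show "ref_point m \<in> lattice_coords V0"
    using ref_weight_pos h_Ints unfolding lattice_coords_ref sum_ref_point
    by (auto simp: ref_point_def)
  have "real m / h < (real k + 1) / h"
    using assms ref_N_pos by (intro divide_strict_right_mono) auto
  also have "\<dots> = 1 / N"
    by (simp add: h_def)
  finally show "0 < ref_point m $ j"
    using ref_weight_pos by (simp add: ref_point_def)
qed

text \<open>Off the root, a positive lattice coordinate is a positive multiple of 1 /
  \<open>weight b j\<close>. A multiple by 2 or more would exceed the least value by at least 1 /
  \<open>weight b i\<close> \<ge> 1 / N, but a positive root coordinate and a sum of at most 1 leave
  less than 1 / N to spare.\<close>

lemma ref_point_exhaust:
  assumes x: "x \<in> lattice_coords V0" "\<And>j. 0 < x $ j" "(\<Sum>j\<in>UNIV. x $ j) \<le> 1"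
  obtains m where "m \<le> k" "x = ref_point m"
proof -
  have ge: "1 / real (weight b j) \<le> x $ j" if j: "j \<noteq> r0" for j
  proof -
    obtain z where z: "real (weight b j) * x $ j = of_int z"
      using x(1) j unfolding lattice_coords_ref by (auto elim: Ints_cases)
    have "0 < real (weight b j) * x $ j"
      using x(2) ref_weight_pos by simp
    then have "1 \<le> real (weight b j) * x $ j"
      unfolding z by simp
    then show ?thesis
      using ref_weight_pos [of j] by (simp add: field_simps)
  qed
  have split: "(\<Sum>j\<in>UNIV. x $ j) = x $ r0 + (\<Sum>j\<in>- {r0}. x $ j)"
    by (simp add: sum.remove [of UNIV r0] Compl_eq_Diff_UNIV)
  have eq: "x $ i = 1 / real (weight b i)" if i: "i \<noteq> r0" for i
  proof (rule ccontr)
    assume ne: "x $ i \<noteq> 1 / real (weight b i)"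
    obtain z where z: "real (weight b i) * x $ i = of_int z"
      using x(1) i unfolding lattice_coords_ref by (auto elim: Ints_cases)
    have "1 / real (weight b i) < x $ i"
      using ge [OF i] ne by linarith
    then have "1 < real (weight b i) * x $ i"
      using ref_weight_pos [of i] by (simp add: pos_divide_less_eq mult.commute)
    then have "2 \<le> real (weight b i) * x $ i"
      unfolding z by simp
    then have "1 / real (weight b i) \<le> x $ i - 1 / real (weight b i)"
      using ref_weight_pos [of i] by (simp add: field_simps)
    also have "\<dots> \<le> (\<Sum>j\<in>- {r0}. x $ j - 1 / real (weight b j))"
      using ge i by (intro member_le_sum) auto
    also have "\<dots> = (\<Sum>j\<in>- {r0}. x $ j) - (1 - 1 / N)"
      using sum_weight [OF b] by (simp add: sum_subtractf N_def)
    also have "\<dots> < 1 / N"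
      using split x(2) [of r0] x(3) by simp
    finally have "N < real (weight b i)"
      using ref_N_pos ref_weight_pos [of i] by (simp add: field_simps)
    moreover have "real (weight b i) \<le> N"
    proof -
      have "1 \<le> (\<Prod>j\<in>- {r0} - {i}. real (weight b j))"
        using ref_weight_pos by (intro prod_ge_1) (simp add: Suc_le_eq)
      moreover have "N = real (weight b i) * (\<Prod>j\<in>- {r0} - {i}. real (weight b j))"
        unfolding N_def prod_weight [OF b, symmetric] using i by (intro prod.remove) auto
      ultimately show ?thesis
        using mult_left_mono [of 1 _ "real (weight b i)"] by fastforce
    qed
    ultimately show False
      by simp
  qed
  have "(\<Sum>j\<in>- {r0}. x $ j) = (\<Sum>j\<in>- {r0}. 1 / real (weight b j))"
    by (intro sum.cong) (auto simp: eq)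
  then have root: "(\<Sum>j\<in>UNIV. x $ j) = x $ r0 + (1 - 1 / N)"
    using split sum_weight [OF b] by (simp add: N_def)
  have "h - h * (\<Sum>j\<in>UNIV. x $ j) \<in> \<int>"
    using x(1) h_Ints unfolding lattice_coords_ref by auto
  moreover have "h * (\<Sum>j\<in>UNIV. x $ j) \<le> h * 1"
    using x(3) ref_N_pos by (intro mult_left_mono) auto
  ultimately obtain m :: nat where m: "h - h * (\<Sum>j\<in>UNIV. x $ j) = real m"
    by (metis Ints_cases diff_ge_0_iff_ge mult.right_neutral nonneg_int_cases of_int_0_le_iff of_int_of_nat_eq)
  then have "real m / h = 1 - (\<Sum>j\<in>UNIV. x $ j)"
    using ref_N_pos by (simp add: field_simps)
  then have xr: "x $ r0 = 1 / N - real m / h"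
    using root by simp
  have "real m / h < (real k + 1) / h"
    using x(2) [of r0] unfolding xr by (simp add: h_def)
  then have "m \<le> k"
    using ref_N_pos by (simp add: divide_less_cancel)
  moreover have "x = ref_point m"
    using eq xr by (auto simp: vec_eq_iff ref_point_def)
  ultimately show thesis
    using that by blast
qed

lemma card_ref_coords: "card (interior_coords V0) = k" "card (facet_coords V0) = 1"
proof -
  have "inj ref_point"
  proof (rule injI)
    fix m m' assume "ref_point m = ref_point m'"
    then have "1 - real m / h = 1 - real m' / h"
      using sum_ref_point by metis
    then show "m = m'"
      using ref_N_pos by simp
  qed
  have "interior_coords V0 = ref_point ` {1..k}"
  proof (intro equalityI subsetI)
    fix x assume x: "x \<in> interior_coords V0"
    then obtain m where m: "m \<le> k" "x = ref_point m"
      by (auto simp: interior_coords_def elim: ref_point_exhaust [of x])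
    have "m \<noteq> 0"
    proof
      assume "m = 0"
      then have "(\<Sum>j\<in>UNIV. x $ j) = 1"
        using m sum_ref_point [of 0] by simp
      then show False
        using x by (simp add: interior_coords_def)
    qed
    then show "x \<in> ref_point ` {1..k}"
      using m by (auto simp: Suc_le_eq)
  next
    fix x assume "x \<in> ref_point ` {1..k}"
    then show "x \<in> interior_coords V0"
      using ref_point_in sum_ref_point ref_N_pos by (auto simp: interior_coords_def)
  qed
  then show "card (interior_coords V0) = k"
    using \<open>inj ref_point\<close> by (simp add: card_image inj_on_subset)
  have "facet_coords V0 = {ref_point 0}"
  proof (intro equalityI subsetI)
    fix x assume x: "x \<in> facet_coords V0"
    then obtain m where m: "m \<le> k" "x = ref_point m"
      by (auto simp: facet_coords_def elim: ref_point_exhaust [of x])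
    then have "m = 0"
      using x sum_ref_point [of m] ref_N_pos by (auto simp: facet_coords_def)
    then show "x \<in> {ref_point 0}"
      using m by simp
  next
    fix x assume "x \<in> {ref_point 0}"
    then show "x \<in> facet_coords V0"
      using ref_point_in [of 0] sum_ref_point [of 0] by (auto simp: facet_coords_def)
  qed
  then show "card (facet_coords V0) = 1"
    by simp
qed

lemma sylvester_simplex_in: "sylvester_simplex b k \<in> simplices_int_facet k 1"
proof -
  have "0 < \<bar>det V0\<bar>"
    unfolding abs_det_ref using ref_N_pos by simp
  then have "det V0 \<noteq> 0"
    by simp
  moreover have "ref_apex b k \<in> int_lattice"
    using h_Ints by (simp add: ref_apex_def h_def N_def int_lattice_simps)
  moreover have "range (ref_vertex b) \<subseteq> int_lattice"
    by (auto simp: ref_vertex_def)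
  ultimately show ?thesis
    unfolding simplices_int_facet_iff using sylvester_simplex_eq [OF b] card_ref_coords by blast
qed

lemma measure_sylvester_simplex: "measure lebesgue (sylvester_simplex b k) = h * N / fact CARD('n)"
  unfolding sylvester_simplex_eq [OF b] measure_simplex abs_det_ref ..

end

text \<open>V maps the frame vectors and -(1 / h) e_r to integer vectors, and the determinant shows
  that they form a basis of the integer lattice. Sending the standard basis to them and the origin
  to \<open>v r\<close> carries the reference simplex to the given one.\<close>

lemma unimodular_equivalence:
  fixes a :: "real ^ 'n" and b c :: "nat \<Rightarrow> 'n"
  assumes a: "a \<in> int_lattice" "range v \<subseteq> int_lattice"
    and b: "bij_betw b {1..CARD('n)} UNIV" and c: "bij_betw c {1..CARD('n)} UNIV"
  defines "N \<equiv> real (sylvester CARD('n)) - 1"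
  assumes det: "\<bar>det (edge_matrix a v)\<bar> = (real k + 1) * N * N"
    and frame: "\<And>i. i \<noteq> c CARD('n) \<Longrightarrow> frame_vec (c CARD('n)) (weight c) i \<in> lattice_coords (edge_matrix a v)"
    and root: "(1 / ((real k + 1) * N)) *\<^sub>R axis (c CARD('n)) 1 \<in> lattice_coords (edge_matrix a v)"
  shows "\<exists>\<phi>. unimodular_transformation \<phi> \<and> convex hull (insert a (range v)) = \<phi> ` sylvester_simplex b k"
proof -
  define V where "V = edge_matrix a v"
  define r where "r = c CARD('n)"
  define h where "h = (real k + 1) * N"
  define F where "F = frame_matrix r (weight c) (- (1 / h) *\<^sub>R axis r 1)"
  \<comment> \<open>\<open>p\<close> matches indices at equal positions in b and c, so it preserves
    weights and takes root to root.\<close>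
  define p where "p j = c (inv_into {1..CARD('n)} b j)" for j
  have "bij p"
    unfolding p_def using bij_betw_trans [OF bij_betw_inv_into [OF b] c] by (simp add: o_def)
  then have p: "p permutes UNIV"
    by (intro bij_imp_permutes) auto
  define G where "G = (\<chi> i j. F $ i $ p j)"
  define M where "M = V ** G"
  have N: "N > 0" "h > 0"
    using ref_N_pos [OF c] by (simp_all add: N_def h_def)
  have "\<bar>det F\<bar> = 1 / (h * N)"
    using abs_det_frame_matrix [OF c] by (simp add: F_def r_def h_def N_def)
  moreover have "\<bar>det G\<bar> = \<bar>det F\<bar>"
    unfolding G_def det_permute_columns [OF p] by (simp add: abs_mult sign_def)
  ultimately have detM: "\<bar>det M\<bar> = 1"
    using det N by (simp add: M_def det_mul abs_mult V_def h_def)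
  have M_axis: "M *v axis j 1 = V *v (if p j = r then - (1 / h) *\<^sub>R axis r 1 else frame_vec r (weight c) (p j))" for j
  proof -
    have "G *v axis j 1 = F *v axis (p j) 1"
      by (simp add: matrix_vector_mult_basis column_def G_def)
    then show ?thesis
      unfolding M_def by (simp add: F_def frame_matrix_mult_axis flip: matrix_vector_mul_assoc)
  qed
  have M_int: "M $ i $ j \<in> \<int>" for i j
  proof -
    have "- (1 / h) *\<^sub>R axis r 1 \<in> lattice_coords V"
      using lattice_coords_simps(4) [OF root] by (simp add: V_def r_def h_def)
    then have "M *v axis j 1 \<in> int_lattice"
      using frame [of "p j"] unfolding M_axis by (auto simp: lattice_coords_def V_def r_def)
    then show ?thesis
      by (simp add: matrix_vector_mult_basis column_def int_lattice_def)
  qed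
  define \<phi> where "\<phi> x = M *v x + v r" for x
  have vr: "v r \<in> int_lattice"
    using a by auto
  have "unimodular_transformation \<phi>"
    unfolding unimodular_transformation_def
  proof
    show "\<exists>f c. linear f \<and> \<phi> = (\<lambda>x. f x + c)"
      by (intro exI [of _ "(*v) M"] exI [of _ "v r"]) (auto simp: \<phi>_def)
    have "\<phi> ` int_lattice = (\<lambda>x. x + v r) ` (*v) M ` int_lattice"
      by (simp add: \<phi>_def image_image)
    also have "(*v) M ` int_lattice = int_lattice"
      by (rule unimodular_matrix_image_int_lattice [OF M_int detM])
    also have "(\<lambda>x. x + v r) ` int_lattice = int_lattice"
    proof (intro equalityI subsetI)
      fix x :: "real ^ 'n" assume "x \<in> int_lattice"
      then show "x \<in> (\<lambda>x. x + v r) ` int_lattice"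
        using vr by (intro image_eqI [of _ _ "x - v r"]) auto
    qed (use vr in auto)
    finally show "\<phi> ` int_lattice = int_lattice" .
  qed
  moreover have "convex hull (insert a (range v)) = \<phi> ` sylvester_simplex b k"
  proof -
    have p_enum: "p (b CARD('n)) = r"
      unfolding p_def r_def using bij_betw_inv_into_left [OF b, of "CARD('n)"] by (simp add: Suc_le_eq)
    have p_root: "p j = r \<longleftrightarrow> j = b CARD('n)" for j
      using \<open>bij p\<close> p_enum by (metis bij_is_inj injD)
    have weights: "weight c (p j) = weight b j" for j
    proof -
      have "inv_into {1..CARD('n)} b j \<in> {1..CARD('n)}"
        using b by (metis UNIV_I bij_betw_def inv_into_into)
      then show ?thesis
        unfolding p_def using weight_enum [OF c] by (simp add: weight_def)
    qed
    have "\<phi> (ref_apex b k) = a"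
    proof -
      have "M *v ref_apex b k = h *\<^sub>R (M *v axis (b CARD('n)) 1)"
        by (simp add: ref_apex_def matrix_vector_mult_scaleR h_def N_def)
      also have "\<dots> = - (V *v axis r 1)"
        unfolding M_axis p_enum using N
        by (simp add: matrix_vector_mult_scaleR flip: scaleR_minus_left)
      finally show ?thesis
        by (simp add: \<phi>_def V_def)
    qed
    moreover have "\<phi> (ref_vertex b j) = v (p j)" for j
    proof (cases "p j = r")
      case True
      then have "j = b CARD('n)"
        by (simp add: p_root)
      then show ?thesis
        by (simp add: \<phi>_def ref_vertex_def p_enum)
    next
      case False
      have "M *v ref_vertex b j = real (weight b j) *\<^sub>R (V *v frame_vec r (weight c) (p j))"
        using False M_axis [of j] by (simp add: ref_vertex_def p_root matrix_vector_mult_scaleR)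
      also have "\<dots> = V *v (axis (p j) 1 - axis r 1)"
        using weight_ge_2 [OF b, of j] by (simp add: frame_vec_def weights matrix_vector_mult_scaleR)
      finally show ?thesis
        by (simp add: \<phi>_def V_def matrix_vector_mult_diff_distrib)
    qed
    ultimately have "\<phi> ` insert (ref_apex b k) (range (ref_vertex b)) = insert a (v ` range p)"
      by (simp add: image_image)
    then have verts: "\<phi> ` insert (ref_apex b k) (range (ref_vertex b)) = insert a (range v)"
      using \<open>bij p\<close> by (simp add: bij_is_surj)
    have \<phi>: "\<phi> ` A = (+) (v r) ` (*v) M ` A" for A
      by (simp add: \<phi>_def image_image add.commute)
    show ?thesis
      unfolding sylvester_simplex_eq [OF b] verts [symmetric] \<phi>
      by (simp only: convex_hull_translation convex_hull_linear_image [OF matrix_vector_mul_linear])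
  qed
  ultimately show ?thesis
    by blast
qed

theorem theorem1p3:
  fixes b :: "nat \<Rightarrow> 'n::finite" and k :: nat
  assumes "CARD('n) \<ge> 2"
    and "bij_betw b {1..CARD('n)} UNIV"
  shows "sylvester_simplex b k \<in> simplices_int_facet k 1
    \<and> (\<forall>S \<in> (simplices_int_facet k 1 :: (real ^ 'n) set set).
          measure lebesgue S \<le> measure lebesgue (sylvester_simplex b k))
    \<and> (\<forall>S \<in> (simplices_int_facet k 1 :: (real ^ 'n) set set).
          measure lebesgue S = measure lebesgue (sylvester_simplex b k) \<longrightarrow>
          (\<exists>\<phi>. unimodular_transformation \<phi> \<and> S = \<phi> ` sylvester_simplex b k))"
proof -
  define N where "N = real (sylvester CARD('n)) - 1"
  have ref: "measure lebesgue (sylvester_simplex b k) = (real k + 1) * N * N / fact CARD('n)"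
    using measure_sylvester_simplex [OF assms(2)] by (simp add: N_def)
  have "measure lebesgue S \<le> measure lebesgue (sylvester_simplex b k) \<and>
      (measure lebesgue S = measure lebesgue (sylvester_simplex b k) \<longrightarrow>
        (\<exists>\<phi>. unimodular_transformation \<phi> \<and> S = \<phi> ` sylvester_simplex b k))"
    if S_in: "S \<in> simplices_int_facet k 1" for S :: "(real ^ 'n) set"
  proof -
    obtain a v where d: "det (edge_matrix a v) \<noteq> 0" and int: "a \<in> int_lattice" "range v \<subseteq> int_lattice"
      and S: "S = convex hull (insert a (range v))"
      and cards: "card (interior_coords (edge_matrix a v)) = k" "card (facet_coords (edge_matrix a v)) = 1"
      using S_in unfolding simplices_int_facet_iff by blast
    have "edge_matrix a v $ i $ j \<in> \<int>" for i j
    proof -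
      have "v j - a \<in> int_lattice"
        using int by blast
      then show ?thesis
        by (simp add: edge_matrix_def int_lattice_def)
    qed
    moreover obtain \<beta> where "facet_coords (edge_matrix a v) = {\<beta>}"
      using cards(2) by (auto simp: card_1_singleton_iff)
    ultimately interpret unique_facet_point "edge_matrix a v" \<beta>
      using d by unfold_locales
    have vol: "measure lebesgue S = \<bar>det (edge_matrix a v)\<bar> / fact CARD('n)"
      unfolding S by (rule measure_simplex)
    have "\<bar>det (edge_matrix a v)\<bar> \<le> (real k + 1) * N * N"
      using det_le(1) by (simp add: cards N_def power2_eq_square)
    then have "measure lebesgue S \<le> measure lebesgue (sylvester_simplex b k)"
      unfolding vol ref by (intro divide_right_mono) auto
    moreover have "\<exists>\<phi>. unimodular_transformation \<phi> \<and> S = \<phi> ` sylvester_simplex b k"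
      if "measure lebesgue S = measure lebesgue (sylvester_simplex b k)"
    proof -
      have det: "\<bar>det (edge_matrix a v)\<bar> = (real k + 1) * N * N"
        using that unfolding vol ref by simp
      then obtain c where "bij_betw c {1..CARD('n)} UNIV"
        "\<forall>i. i \<noteq> c CARD('n) \<longrightarrow> frame_vec (c CARD('n)) (weight c) i \<in> lattice_coords (edge_matrix a v)"
        "(1 / ((real k + 1) * N)) *\<^sub>R axis (c CARD('n)) 1 \<in> lattice_coords (edge_matrix a v)"
        using det_le(2) assms(1) by (auto simp: cards N_def power2_eq_square mult.assoc)
      then show ?thesis
        unfolding S using unimodular_equivalence [OF int assms(2)] det by (auto simp: N_def)
    qed
    ultimately show ?thesis
      by blast
  qed
  then show ?thesis
    using sylvester_simplex_in [OF assms(2)] by blast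
qed

end
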